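(* Let $\lambda$ be a partition with conjugate $\lambda'$, let $t$ be the number of diagonal boxes of $\lambda$ (the number of $i$ with $(i,i)\in D(\lambda)$), and put $p_i=\lambda_i-i+1$ and $q_i=\lambda'_i-i$ for $1\le i\le t$. Let $\boldsymbol{s}=(s_{ij})\in W^{\mathrm{diag}}_\lambda$ and write $a_k=s_{i,i+k}$ for $k\in\mathbb{Z}$. Assume further that $\Re(s_{i,\lambda_i})=\Re(a_{p_i-1})>1$ and $\Re(s_{\lambda'_i,i})=\Re(a_{-q_i})>1$ for $1\le i\le t$. Then $$\zeta_\lambda(\boldsymbol{s})=\det\left[\zeta_{(p_i,1^{q_j})}(\boldsymbol{s}_{i,j})\right]_{1\le i,j\le t},$$ where $\boldsymbol{s}_{i,j}\in W_{(p_i,1^{q_j})}$ is the tableau of hook shape $(p_i,1^{q_j})$ whose first row is $a_0,a_1,\ldots,a_{p_i-1}$ and whose first column is $a_0,a_{-1},\ldots,a_{-q_j}$ (from top to bottom).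
   Context: For a partition $\lambda$: $D(\lambda)=\{(i,j):1\le i\le\ell(\lambda),\ 1\le j\le\lambda_i\}$, $\lambda'_i=\#\{j:\lambda_j\ge i\}$. $C(\lambda)$ is the set of corners, i.e. $(i,j)\in D(\lambda)$ with $(i+1,j),(i,j+1)\notin D(\lambda)$. $(p,1^q)$ is the partition with one part $p$ and $q$ parts equal to $1$. $T(\lambda,X)$ is the set of fillings of $D(\lambda)$ by elements of $X$; $T^{\mathrm{diag}}(\lambda,X)$ is the subset with $t_{ij}=t_{kl}$ whenever $j-i=l-k$. $\mathrm{SSYT}(\lambda)$ is the set of semi-standard fillings by positive integers (rows weakly increasing, columns strictly increasing). For $\boldsymbol{s}\in T(\lambda,\mathbb{C})$, $$\zeta_\lambda(\boldsymbol{s})=\sum_{(m_{ij})\in\mathrm{SSYT}(\lambda)}\prod_{(i,j)\in D(\lambda)}m_{ij}^{-s_{ij}}.$$ $W_\lambda$ is the set of $\boldsymbol{s}\in T(\lambda,\mathbb{C})$ with $\Re(s_{ij})\ge1$ for $(i,j)\in D(\lambda)\setminus C(\lambda)$ and $\Re(s_{ij})>1$ for $(i,j)\in C(\lambda)$ (the series converges absolutely there); $W^{\mathrm{diag}}_\lambda=W_\lambda\cap T^{\mathrm{diag}}(\lambda,\mathbb{C})$. *)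

theory Defs
  imports "HOL-Analysis.Infinite_Sum" "HOL-Analysis.Complex_Transcendental" "HOL-Library.FuncSet" "Jordan_Normal_Form.Determinant"
begin

text \<open>Partitions are weakly decreasing lists of positive parts (the empty partition included);
  parts, rows and columns are numbered from 1.\<close>

definition is_partition :: "nat list \<Rightarrow> bool" where
  "is_partition lam \<longleftrightarrow> sorted_wrt (\<ge>) lam \<and> (\<forall>x\<in>set lam. 0 < x)"

definition part :: "nat list \<Rightarrow> nat \<Rightarrow> nat" where
  "part lam i = (if 1 \<le> i \<and> i \<le> length lam then lam ! (i - 1) else 0)"

definition conj_part :: "nat list \<Rightarrow> nat \<Rightarrow> nat" where
  "conj_part lam i = card {j. 1 \<le> j \<and> j \<le> length lam \<and> part lam j \<ge> i}"

definition diagram :: "nat list \<Rightarrow> (nat \<times> nat) set" where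
  "diagram lam = {(i, j). 1 \<le> i \<and> i \<le> length lam \<and> 1 \<le> j \<and> j \<le> part lam i}"

definition corners :: "nat list \<Rightarrow> (nat \<times> nat) set" where
  "corners lam = {(i, j) \<in> diagram lam. (i + 1, j) \<notin> diagram lam \<and> (i, j + 1) \<notin> diagram lam}"

definition diag_length :: "nat list \<Rightarrow> nat" where
  "diag_length lam = card {i. (i, i) \<in> diagram lam}"

definition hook :: "nat \<Rightarrow> nat \<Rightarrow> nat list" where
  "hook p q = p # replicate q 1"

text \<open>Fillings are extensional functions (\<^term>\<open>undefined\<close> outside the diagram), so that each
  filling is represented by exactly one function and sums over fillings do not overcount.\<close>

definition fillings :: "nat list \<Rightarrow> 'a set \<Rightarrow> (nat \<times> nat \<Rightarrow> 'a) set" where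
  "fillings lam X = (diagram lam \<rightarrow>\<^sub>E X)"

definition diag_fillings :: "nat list \<Rightarrow> 'a set \<Rightarrow> (nat \<times> nat \<Rightarrow> 'a) set" where
  "diag_fillings lam X = {f \<in> fillings lam X.
     \<forall>i j k l. (i, j) \<in> diagram lam \<longrightarrow> (k, l) \<in> diagram lam \<longrightarrow>
       int j - int i = int l - int k \<longrightarrow> f (i, j) = f (k, l)}"

definition SSYT :: "nat list \<Rightarrow> (nat \<times> nat \<Rightarrow> nat) set" where
  "SSYT lam = {m \<in> fillings lam {1..}.
     (\<forall>i j j'. (i, j) \<in> diagram lam \<longrightarrow> (i, j') \<in> diagram lam \<longrightarrow> j < j' \<longrightarrow> m (i, j) \<le> m (i, j')) \<and>
     (\<forall>i i' j. (i, j) \<in> diagram lam \<longrightarrow> (i', j) \<in> diagram lam \<longrightarrow> i < i' \<longrightarrow> m (i, j) < m (i', j))}"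

text \<open>For complex-valued families, \<^const>\<open>infsum\<close> is the sum of an absolutely convergent series
  (and 0 if the series does not converge absolutely).\<close>

definition schur_zeta :: "nat list \<Rightarrow> (nat \<times> nat \<Rightarrow> complex) \<Rightarrow> complex" where
  "schur_zeta lam s = (\<Sum>\<^sub>\<infinity>m\<in>SSYT lam. \<Prod>b\<in>diagram lam. (of_nat (m b) :: complex) powr (- s b))"

definition W :: "nat list \<Rightarrow> (nat \<times> nat \<Rightarrow> complex) set" where
  "W lam = {s \<in> fillings lam UNIV.
     (\<forall>b \<in> diagram lam - corners lam. Re (s b) \<ge> 1) \<and> (\<forall>b \<in> corners lam. Re (s b) > 1)}"

definition W_diag :: "nat list \<Rightarrow> (nat \<times> nat \<Rightarrow> complex) set" where
  "W_diag lam = W lam \<inter> diag_fillings lam UNIV"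

definition hook_filling :: "(int \<Rightarrow> complex) \<Rightarrow> nat \<Rightarrow> nat \<Rightarrow> nat \<times> nat \<Rightarrow> complex" where
  "hook_filling a p q = restrict
     (\<lambda>(k, l). if k = 1 then a (int l - 1) else a (1 - int k)) (diagram (hook p q))"

end

theory Submission
  imports Defs
begin

text \<open>Call \<open>j - i\<close> the content of the box \<open>(i, j)\<close>. A filling \<open>s\<close> constant along diagonals makes
  \<open>schur_zeta lam s\<close> a sum over semistandard tableaux \<open>m\<close> in which a box of content \<open>c\<close> with entry
  \<open>n\<close> contributes a factor \<open>w c n\<close> (here \<open>n powr - a c\<close>). For tableaux with bounded entries,
  Giambelli's formula holds whatever the function \<open>w\<close> is, and the reason is that such tableaux can be
  built up one slot \<open>(n, c)\<close> at a time.

  Order the slots by \<open>n\<close> and then by \<open>c\<close>, and let \<open>Z D\<close> be the sum over the tableaux of shape \<open>D\<close> that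
  only use slots up to some point. When the next slot \<open>(n, c)\<close> is admitted, a new tableau uses it for
  exactly one box, and this is the unique removable box \<open>b\<close> of \<open>D\<close> on the diagonal \<open>c\<close>. So \<open>Z D\<close>
  becomes \<open>Z D + w c n * Z (D - {b})\<close>, or stays the same if there is no such \<open>b\<close> (lemmas
  \<open>sum_before_add_box\<close> and \<open>sum_before_no_change\<close>).

  In Frobenius coordinates \<open>(\<alpha> | \<beta>)\<close>, removing a box of content \<open>c > 0\<close> turns the coordinate
  \<open>\<alpha> i = c\<close> into \<open>c - 1\<close>, and it is impossible exactly when \<open>c - 1\<close> already occurs in \<open>\<alpha>\<close>. On the matrix
  with the hook values \<open>Z (\<alpha> i | \<beta> j)\<close> as entries, the same step adds a multiple of the row for \<open>c - 1\<close>
  to the row for \<open>c\<close>. By linearity in that row, the determinant changes as \<open>Z D\<close> does; in the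
  impossible case two rows of the correction coincide. Negative contents are the transposed
  situation, and content \<open>0\<close> only concerns the last diagonal entry of the matrix. Hence the identity
  between \<open>Z D\<close> and the determinant survives every step (lemmas \<open>giambelli_add_pos\<close>,
  \<open>giambelli_add_zero\<close>, \<open>giambelli_add\<close>), and it holds trivially before the first slot.

  It remains to let the bound on the entries tend to infinity, which requires absolute convergence.
  For a hook with exponents of real part at least \<open>1\<close>, and more than \<open>1\<close> at both ends, one sums out the
  end boxes one after the other (\<open>hook_sum_upto_bounded\<close>). For a general diagram, the finite identity for
  the absolute values of the summands presents the truncated sums as a convergent sequence of
  determinants of hook sums (\<open>giambelli_zeta\<close>).\<close>

section \<open>Tableau sums built up slot by slot\<close>

definition box_content :: "nat \<times> nat \<Rightarrow> int" where
  "box_content b = int (snd b) - int (fst b)"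

definition young :: "(nat \<times> nat) set \<Rightarrow> bool" where
  "young D \<longleftrightarrow> finite D \<and> (\<forall>i j. (i, j) \<in> D \<longrightarrow> 1 \<le> i \<and> 1 \<le> j) \<and>
     (\<forall>i j i' j'. (i, j) \<in> D \<longrightarrow> 1 \<le> i' \<longrightarrow> i' \<le> i \<longrightarrow> 1 \<le> j' \<longrightarrow> j' \<le> j \<longrightarrow> (i', j') \<in> D)"

definition removable :: "(nat \<times> nat) set \<Rightarrow> nat \<times> nat \<Rightarrow> bool" where
  "removable D b \<longleftrightarrow> b \<in> D \<and> (fst b + 1, snd b) \<notin> D \<and> (fst b, snd b + 1) \<notin> D"

definition ssyt :: "(nat \<times> nat) set \<Rightarrow> (nat \<times> nat \<Rightarrow> nat) set" where
  "ssyt D = {m \<in> D \<rightarrow>\<^sub>E {1..}.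
     (\<forall>i j j'. (i, j) \<in> D \<longrightarrow> (i, j') \<in> D \<longrightarrow> j < j' \<longrightarrow> m (i, j) \<le> m (i, j')) \<and>
     (\<forall>i i' j. (i, j) \<in> D \<longrightarrow> (i', j) \<in> D \<longrightarrow> i < i' \<longrightarrow> m (i, j) < m (i', j))}"

text \<open>The slots \<open>(n, c)\<close> are ordered by entry first and content second. As long as contents stay
  in \<open>[-L, L]\<close>, this order is faithfully encoded by one integer. Any factor above \<open>2 * L\<close>
  achieves this; one that is at least \<open>2\<close> even for \<open>L = 0\<close> puts \<open>(n + 1, c - 1)\<close> after \<open>(n, c)\<close>
  for every \<open>c\<close>.\<close>
definition slot :: "nat \<Rightarrow> nat \<Rightarrow> int \<Rightarrow> int" where
  "slot L n c = int n * (2 * int L + 2) + c"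

definition ssyt_before :: "nat \<Rightarrow> int \<Rightarrow> (nat \<times> nat) set \<Rightarrow> (nat \<times> nat \<Rightarrow> nat) set" where
  "ssyt_before L \<tau> D = {m \<in> ssyt D. \<forall>b\<in>D. slot L (m b) (box_content b) < \<tau>}"

definition weight :: "(int \<Rightarrow> nat \<Rightarrow> 'a::comm_ring_1) \<Rightarrow> (nat \<times> nat) set \<Rightarrow> (nat \<times> nat \<Rightarrow> nat) \<Rightarrow> 'a" where
  "weight w D m = (\<Prod>b\<in>D. w (box_content b) (m b))"

text \<open>The weight of an entry depends on its box only through the content, but otherwise arbitrarily:
  this is all that a filling constant along diagonals provides, and all that Giambelli's formula
  needs.\<close>
definition sum_before :: "(int \<Rightarrow> nat \<Rightarrow> 'a::comm_ring_1) \<Rightarrow> nat \<Rightarrow> int \<Rightarrow> (nat \<times> nat) set \<Rightarrow> 'a" where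
  "sum_before w L \<tau> D = (\<Sum>m\<in>ssyt_before L \<tau> D. weight w D m)"

lemma slot_mono_entry:
  assumes "n < n'" "\<bar>c\<bar> \<le> int L" "\<bar>c'\<bar> \<le> int L"
  shows "slot L n c + 1 < slot L n' c'"
proof -
  have "(int n + 1) * (2 * int L + 2) \<le> int n' * (2 * int L + 2)"
    using assms(1) by (intro mult_right_mono) auto
  then show ?thesis using assms by (auto simp: slot_def algebra_simps)
qed

lemma slot_inject:
  assumes "slot L n c = slot L n' c'" "\<bar>c\<bar> \<le> int L" "\<bar>c'\<bar> \<le> int L"
  shows "n = n'" "c = c'"
proof -
  show "n = n'"
    using slot_mono_entry[of n n' c L c'] slot_mono_entry[of n' n c' L c] assms
    by (cases n n' rule: linorder_cases) auto
  then show "c = c'" using assms by (simp add: slot_def)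
qed

lemma slot_le_entry:
  assumes "slot L n c \<le> slot L n' c'" "\<bar>c\<bar> \<le> int L" "\<bar>c'\<bar> \<le> int L"
  shows "n \<le> n'"
  using slot_mono_entry[of n' n c' L c] assms by linarith

lemma youngD:
  assumes "young D" "(i, j) \<in> D" "1 \<le> i'" "i' \<le> i" "1 \<le> j'" "j' \<le> j"
  shows "(i', j') \<in> D"
  using assms unfolding young_def by blast

lemma young_pos:
  assumes "young D" "(i, j) \<in> D"
  shows "1 \<le> i" "1 \<le> j"
  using assms unfolding young_def by blast+

text \<open>Of two boxes on one diagonal of a Young diagram, the upper one has a right neighbour, by
  closure of the diagram under going up and left.\<close>
lemma removable_unique:
  assumes "young D" "removable D b" "removable D b'" "box_content b = box_content b'"
  shows "b = b'"
proof -
  obtain i j i' j' where b: "b = (i, j)" "b' = (i', j')" by fastforce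
  have *: False if "i < i'" "int j - int i = int j' - int i'" "(i', j') \<in> D" "(i, j + 1) \<notin> D" "1 \<le> i"
    for i j i' j'
    using youngD[OF assms(1) that(3), of i "j + 1"] that by auto
  have "1 \<le> i" "1 \<le> i'" using assms(2,3) b young_pos(1)[OF assms(1)] by (auto simp: removable_def)
  then show ?thesis
    using *[of i i' j j'] *[of i' i j' j] assms b
    by (cases i i' rule: linorder_cases) (auto simp: removable_def box_content_def)
qed

lemma ssyt_pos: "m \<in> ssyt D \<Longrightarrow> b \<in> D \<Longrightarrow> 1 \<le> m b"
  by (auto simp: ssyt_def PiE_iff)

text \<open>A right neighbour would have at least the same entry and a larger content, a lower neighbour a
  larger entry; both would lie in a later slot, while \<open>\<tau>\<close> is the last slot in use.\<close>
lemma new_box_removable: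
  assumes "young D" "m \<in> ssyt_before L (\<tau> + 1) D" "b \<in> D" "slot L (m b) (box_content b) = \<tau>"
  shows "removable D b"
proof -
  obtain i j where b: "b = (i, j)" by fastforce
  have m: "m \<in> ssyt D" and le: "\<And>b. b \<in> D \<Longrightarrow> slot L (m b) (box_content b) \<le> \<tau>"
    using assms(2) by (auto simp: ssyt_before_def)
  have "(i, j + 1) \<notin> D"
  proof
    assume h: "(i, j + 1) \<in> D"
    then have "m (i, j) \<le> m (i, j + 1)" using m assms(3) b by (auto simp: ssyt_def)
    then have "int (m (i, j)) * (2 * int L + 2) \<le> int (m (i, j + 1)) * (2 * int L + 2)"
      by (intro mult_right_mono) auto
    then show False using le[OF h] assms(4) unfolding b slot_def box_content_def fst_conv snd_conv
      by linarith
  qed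
  moreover have "(i + 1, j) \<notin> D"
  proof
    assume h: "(i + 1, j) \<in> D"
    then have "m (i, j) < m (i + 1, j)" using m assms(3) b by (auto simp: ssyt_def)
    then have "(int (m (i, j)) + 1) * (2 * int L + 2) \<le> int (m (i + 1, j)) * (2 * int L + 2)"
      by (intro mult_right_mono) auto
    then show False using le[OF h] assms(4)
      unfolding b slot_def box_content_def fst_conv snd_conv distrib_right of_nat_add of_nat_1 mult_1_left
      by linarith
  qed
  ultimately show ?thesis using assms b by (simp add: removable_def)
qed

lemma ssyt_before_mono: "\<tau> \<le> \<tau>' \<Longrightarrow> ssyt_before L \<tau> D \<subseteq> ssyt_before L \<tau>' D"
  by (force simp: ssyt_before_def)

lemma finite_ssyt_before:
  assumes "finite D"
  shows "finite (ssyt_before L \<tau> D)"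
proof (rule finite_subset)
  define N where "N = Max ((\<lambda>b. nat \<bar>\<tau> - box_content b\<bar>) ` D)"
  show "ssyt_before L \<tau> D \<subseteq> D \<rightarrow>\<^sub>E {..N}"
  proof
    fix m assume m: "m \<in> ssyt_before L \<tau> D"
    have "m b \<le> N" if "b \<in> D" for b
    proof -
      have "int (m b) * 1 \<le> int (m b) * (2 * int L + 2)" by (intro mult_left_mono) auto
      moreover have "slot L (m b) (box_content b) < \<tau>" using m that by (auto simp: ssyt_before_def)
      ultimately have "m b \<le> nat \<bar>\<tau> - box_content b\<bar>" by (simp add: slot_def)
      also have "\<dots> \<le> N" unfolding N_def using that assms by (intro Max_ge) auto
      finally show ?thesis .
    qed
    then show "m \<in> D \<rightarrow>\<^sub>E {..N}" using m by (auto simp: ssyt_before_def ssyt_def PiE_iff)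
  qed
  show "finite (D \<rightarrow>\<^sub>E {..N})" using assms by (intro finite_PiE) auto
qed

lemma sum_before_no_change:
  assumes "young D" "\<And>b. removable D b \<Longrightarrow> box_content b = c \<Longrightarrow> False"
    and "\<And>b. b \<in> D \<Longrightarrow> \<bar>box_content b\<bar> \<le> int L" "\<bar>c\<bar> \<le> int L"
  shows "sum_before w L (slot L n c + 1) D = sum_before w L (slot L n c) D"
proof -
  have "m \<in> ssyt_before L (slot L n c) D" if m: "m \<in> ssyt_before L (slot L n c + 1) D" for m
  proof -
    have "slot L (m b) (box_content b) < slot L n c" if "b \<in> D" for b
    proof -
      have "slot L (m b) (box_content b) \<noteq> slot L n c"
        using new_box_removable[OF assms(1) m that] assms(2)[of b] assms(3)[OF that] assms(4)
          slot_inject(2)[of L "m b" "box_content b" n c] by metis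
      moreover have "slot L (m b) (box_content b) < slot L n c + 1"
        using m that by (auto simp: ssyt_before_def)
      ultimately show ?thesis by linarith
    qed
    then show ?thesis using m by (auto simp: ssyt_before_def)
  qed
  then have "ssyt_before L (slot L n c + 1) D = ssyt_before L (slot L n c) D"
    using ssyt_before_mono[of "slot L n c" "slot L n c + 1" L D] by auto
  then show ?thesis by (simp add: sum_before_def)
qed

lemma ssyt_delete:
  assumes "m \<in> ssyt D"
  shows "m(b := undefined) \<in> ssyt (D - {b})"
  using assms by (auto simp: ssyt_def PiE_iff extensional_def)

text \<open>The tableaux that become available at the slot \<open>\<tau> = (n, c)\<close> have \<open>n\<close> in the removable box of
  content \<open>c\<close> and nowhere else on its diagonal. Deleting that box leaves an arbitrary tableau with
  earlier slots: what is left of the box is at most \<open>n\<close>, and what is above it has larger content,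
  hence, being in an earlier slot, an entry below \<open>n\<close>.\<close>
lemma sum_before_add_box:
  assumes "young D" "removable D b" "1 \<le> n"
    and bound: "\<And>b. b \<in> D \<Longrightarrow> \<bar>box_content b\<bar> \<le> int L"
  shows "sum_before w L (slot L n (box_content b) + 1) D =
    sum_before w L (slot L n (box_content b)) D + w (box_content b) n * sum_before w L (slot L n (box_content b)) (D - {b})"
proof -
  define \<tau> where "\<tau> = slot L n (box_content b)"
  define A where "A = ssyt_before L (\<tau> + 1) D - ssyt_before L \<tau> D"
  obtain i j where b: "b = (i, j)" by fastforce
  have bD: "b \<in> D" and fin: "finite D" using assms(1,2) unfolding removable_def young_def by blast+
  have row: "j' < j" if "(i, j') \<in> D" "j' \<noteq> j" for j'
  proof (rule ccontr)
    assume "\<not> j' < j"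
    moreover have "1 \<le> i" using young_pos[OF assms(1)] bD b by blast
    ultimately have "(i, j + 1) \<in> D" using youngD[OF assms(1) that(1), of i "j + 1"] that by auto
    then show False using assms(2) b by (simp add: removable_def)
  qed
  have col: "i' < i" if "(i', j) \<in> D" "i' \<noteq> i" for i'
  proof (rule ccontr)
    assume "\<not> i' < i"
    moreover have "1 \<le> j" using young_pos[OF assms(1)] bD b by blast
    ultimately have "(i + 1, j) \<in> D" using youngD[OF assms(1) that(1), of "i + 1" j] that by auto
    then show False using assms(2) b by (simp add: removable_def)
  qed
  have mb: "m b = n" and rest: "\<And>b'. b' \<in> D \<Longrightarrow> b' \<noteq> b \<Longrightarrow> slot L (m b') (box_content b') < \<tau>"
    if m: "m \<in> A" for m
  proof -
    have mA: "m \<in> ssyt_before L (\<tau> + 1) D" using m by (simp add: A_def)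
    have eq: "b' = b \<and> m b' = n" if "b' \<in> D" "slot L (m b') (box_content b') = \<tau>" for b'
    proof -
      note inj = slot_inject[OF that(2)[unfolded \<tau>_def] bound[OF that(1)] bound[OF bD]]
      show ?thesis
        using removable_unique[OF assms(1) new_box_removable[OF assms(1) mA that] assms(2) inj(2)] inj(1)
        by blast
    qed
    have le: "slot L (m b') (box_content b') < \<tau> + 1" if "b' \<in> D" for b'
      using mA that by (auto simp: ssyt_before_def)
    show rest: "slot L (m b') (box_content b') < \<tau>" if "b' \<in> D" "b' \<noteq> b" for b'
      using eq[of b'] le[of b'] that by linarith
    obtain b' where "b' \<in> D" "slot L (m b') (box_content b') \<ge> \<tau>"
      using m by (force simp: A_def ssyt_before_def)
    then show "m b = n" using eq[of b'] le[of b'] by auto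
  qed
  have fwd: "m(b := undefined) \<in> ssyt_before L \<tau> (D - {b})" if "m \<in> A" for m
    using that ssyt_delete[of m D b] rest[OF that] by (auto simp: A_def ssyt_before_def)
  have bwd: "m(b := n) \<in> A" if m: "m \<in> ssyt_before L \<tau> (D - {b})" for m
  proof -
    have s: "m \<in> ssyt (D - {b})" and lt: "\<And>b'. b' \<in> D \<Longrightarrow> b' \<noteq> b \<Longrightarrow> slot L (m b') (box_content b') < \<tau>"
      using m by (auto simp: ssyt_before_def)
    have le: "m b' \<le> n" if "b' \<in> D" "b' \<noteq> b" for b'
      using lt[OF that] slot_le_entry[of L "m b'" "box_content b'" n "box_content b"] bound[OF that(1)] bound[OF bD]
      by (simp add: \<tau>_def)
    have less: "m (i', j) < n" if "(i', j) \<in> D" "i' < i" for i'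
      using lt[OF that(1)] le[OF that(1)] that b
      by (cases "m (i', j) = n") (auto simp: \<tau>_def slot_def box_content_def)
    have "m(b := n) \<in> D \<rightarrow>\<^sub>E {1..}"
      using s assms(3) bD by (auto simp: ssyt_def PiE_iff extensional_def)
    moreover have "(m(b := n)) (i1, j1) \<le> (m(b := n)) (i1, j2)"
      if "(i1, j1) \<in> D" "(i1, j2) \<in> D" "j1 < j2" for i1 j1 j2
      using s that le[of "(i1, j1)"] row[of j2] b by (auto simp: ssyt_def)
    moreover have "(m(b := n)) (i1, j1) < (m(b := n)) (i2, j1)"
      if "(i1, j1) \<in> D" "(i2, j1) \<in> D" "i1 < i2" for i1 i2 j1
      using s that less[of i1] col[of i2] b by (auto simp: ssyt_def)
    ultimately have "m(b := n) \<in> ssyt D" by (auto simp: ssyt_def)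
    then show ?thesis using lt bD by (force simp: A_def ssyt_before_def \<tau>_def)
  qed
  have "(\<Sum>m\<in>A. weight w D m) = (\<Sum>m\<in>ssyt_before L \<tau> (D - {b}). w (box_content b) n * weight w (D - {b}) m)"
  proof (rule sum.reindex_bij_witness[of _ "\<lambda>m. m(b := n)" "\<lambda>m. m(b := undefined)"])
    fix m assume m: "m \<in> A"
    show "(m(b := undefined))(b := n) = m" using mb[OF m] by auto
    show "m(b := undefined) \<in> ssyt_before L \<tau> (D - {b})" by (rule fwd[OF m])
    have "weight w D m = w (box_content b) (m b) * (\<Prod>b\<in>D - {b}. w (box_content b) (m b))"
      unfolding weight_def using bD fin by (rule prod.remove[rotated])
    then show "w (box_content b) n * weight w (D - {b}) (m(b := undefined)) = weight w D m"
      using mb[OF m] by (simp add: weight_def)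
  next
    fix m assume m: "m \<in> ssyt_before L \<tau> (D - {b})"
    show "m(b := n) \<in> A" by (rule bwd[OF m])
    have "m \<in> D - {b} \<rightarrow>\<^sub>E {1..}" using m by (simp add: ssyt_before_def ssyt_def)
    then have "m b = undefined" by (rule PiE_arb) simp
    then show "(m(b := n))(b := undefined) = m" by auto
  qed
  moreover have "sum_before w L (\<tau> + 1) D = sum_before w L \<tau> D + (\<Sum>m\<in>A. weight w D m)"
    unfolding sum_before_def A_def using finite_ssyt_before[OF fin] ssyt_before_mono[of \<tau> "\<tau> + 1" L D]
    by (subst sum.subset_diff[of "ssyt_before L \<tau> D"]) (auto simp: add.commute)
  ultimately show ?thesis by (simp add: \<tau>_def sum_before_def sum_distrib_left)
qed

section \<open>Frobenius coordinates and their removable boxes\<close>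

text \<open>The diagram with Frobenius coordinates \<open>(\<alpha> 1, \<dots>, \<alpha> t | \<beta> 1, \<dots>, \<beta> t)\<close>: the diagonal box
  \<open>(i, i)\<close> has \<open>\<alpha> i\<close> boxes to its right and \<open>\<beta> i\<close> boxes below it. The hook with arm \<open>a\<close> and leg
  \<open>b\<close> is the case \<open>t = 1\<close>, and the determinants below are over the hooks \<open>(\<alpha> i | \<beta> j)\<close>.\<close>
definition frobenius :: "nat \<Rightarrow> (nat \<Rightarrow> nat) \<Rightarrow> (nat \<Rightarrow> nat) \<Rightarrow> (nat \<times> nat) set" where
  "frobenius t \<alpha> \<beta> = {(i, j). 1 \<le> i \<and> 1 \<le> j \<and>
     (if i \<le> j then i \<le> t \<and> j \<le> i + \<alpha> i else j \<le> t \<and> i \<le> j + \<beta> j)}"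

definition decreasing_upto :: "nat \<Rightarrow> nat \<Rightarrow> (nat \<Rightarrow> nat) \<Rightarrow> bool" where
  "decreasing_upto L t \<alpha> \<longleftrightarrow> (\<forall>i j. 1 \<le> i \<longrightarrow> i < j \<longrightarrow> j \<le> t \<longrightarrow> \<alpha> j < \<alpha> i) \<and> (\<forall>i\<in>{1..t}. \<alpha> i \<le> L)"

definition hook_shape :: "nat \<Rightarrow> nat \<Rightarrow> (nat \<times> nat) set" where
  "hook_shape a b = frobenius 1 (\<lambda>_. a) (\<lambda>_. b)"

definition giambelli :: "nat \<Rightarrow> ((nat \<times> nat) set \<Rightarrow> 'a::comm_ring_1) \<Rightarrow> bool" where
  "giambelli L Z \<longleftrightarrow> (\<forall>t \<alpha> \<beta>. decreasing_upto L t \<alpha> \<longrightarrow> decreasing_upto L t \<beta> \<longrightarrow>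
     Z (frobenius t \<alpha> \<beta>) =
       Determinant.det (Matrix.mat t t (\<lambda>(i, j). Z (hook_shape (\<alpha> (i + 1)) (\<beta> (j + 1))))))"

lemma decreasing_uptoD:
  assumes "decreasing_upto L t \<alpha>"
  shows "1 \<le> i \<Longrightarrow> i < j \<Longrightarrow> j \<le> t \<Longrightarrow> \<alpha> j < \<alpha> i"
    and "1 \<le> i \<Longrightarrow> i \<le> t \<Longrightarrow> \<alpha> i \<le> L"
  using assms by (auto simp: decreasing_upto_def)

text \<open>Row \<open>i\<close> of the diagram ends in column \<open>i + \<alpha> i\<close>, so this says that rows weakly decrease.\<close>
lemma decreasing_upto_shift:
  assumes "decreasing_upto L t \<alpha>" "1 \<le> i" "i \<le> j" "j \<le> t"
  shows "\<alpha> j + j \<le> \<alpha> i + i"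
  using assms(3,4)
proof (induction j rule: dec_induct)
  case (step j)
  then show ?case using decreasing_uptoD(1)[OF assms(1), of j "Suc j"] assms(2) by auto
qed simp

lemma decreasing_upto_one: "decreasing_upto L 1 (\<lambda>_. a) \<longleftrightarrow> a \<le> L"
  by (auto simp: decreasing_upto_def)

lemma young_frobenius:
  assumes "decreasing_upto L t \<alpha>" "decreasing_upto L t \<beta>"
  shows "young (frobenius t \<alpha> \<beta>)"
proof -
  have "frobenius t \<alpha> \<beta> \<subseteq> {1..t + L} \<times> {1..t + L}"
    using decreasing_uptoD(2)[OF assms(1)] decreasing_uptoD(2)[OF assms(2)]
    by (force simp: frobenius_def split: if_splits)
  then have "finite (frobenius t \<alpha> \<beta>)" by (rule finite_subset) auto
  moreover have "(i', j') \<in> frobenius t \<alpha> \<beta>"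
    if ij: "(i, j) \<in> frobenius t \<alpha> \<beta>" "1 \<le> i'" "i' \<le> i" "1 \<le> j'" "j' \<le> j" for i j i' j'
  proof (cases "i' \<le> j'")
    case True
    show ?thesis
    proof (cases "i \<le> j")
      case le: True
      then show ?thesis using that True decreasing_upto_shift[OF assms(1), of i' i]
        by (auto simp: frobenius_def)
    next
      case False
      then show ?thesis using that True decreasing_upto_shift[OF assms(1), of i' t]
        by (auto simp: frobenius_def)
    qed
  next
    case False
    show ?thesis
    proof (cases "i \<le> j")
      case True
      then show ?thesis using that False decreasing_upto_shift[OF assms(2), of j' t]
        by (auto simp: frobenius_def)
    next
      case gt: False
      then show ?thesis using that False decreasing_upto_shift[OF assms(2), of j' j]
        by (auto simp: frobenius_def)
    qed
  qed
  moreover have "1 \<le> i \<and> 1 \<le> j" if "(i, j) \<in> frobenius t \<alpha> \<beta>" for i j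
    using that by (simp add: frobenius_def)
  ultimately show ?thesis unfolding young_def by blast
qed

lemma box_content_bound:
  assumes "decreasing_upto L t \<alpha>" "decreasing_upto L t \<beta>" "b \<in> frobenius t \<alpha> \<beta>"
  shows "\<bar>box_content b\<bar> \<le> int L"
  using assms(3) decreasing_uptoD(2)[OF assms(1), of "fst b"] decreasing_uptoD(2)[OF assms(2), of "snd b"]
  by (auto simp: frobenius_def box_content_def split: if_splits)

lemma frobenius_swap: "prod.swap ` frobenius t \<alpha> \<beta> = frobenius t \<beta> \<alpha>"
proof -
  have *: "(j, i) \<in> frobenius t \<beta> \<alpha> \<longleftrightarrow> (i, j) \<in> frobenius t \<alpha> \<beta>" for i j
    by (auto simp: frobenius_def)
  then show ?thesis by (force simp: image_iff)
qed

text \<open>Right of the main diagonal, removing a box means lowering one \<open>\<alpha> i\<close> by one, which, for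
  decreasing \<open>\<alpha>\<close>, is possible unless the lowered value is already taken by \<open>\<alpha> (i + 1)\<close>.\<close>
lemma removable_frobenius_pos:
  assumes "1 \<le> k"
  shows "removable (frobenius t \<alpha> \<beta>) b \<and> box_content b = int k \<longleftrightarrow>
    (\<exists>i\<in>{1..t}. \<alpha> i = k \<and> (i < t \<longrightarrow> \<alpha> (i + 1) + 1 < k) \<and> b = (i, i + k))"
proof (cases b)
  case (Pair i j)
  have "box_content (i, j) = int k \<longleftrightarrow> j = i + k" by (auto simp: box_content_def)
  then show ?thesis using assms by (auto simp: Pair removable_def frobenius_def)
qed

lemma frobenius_delete_pos:
  assumes "1 \<le> k" "i \<in> {1..t}" "\<alpha> i = k"
  shows "frobenius t \<alpha> \<beta> - {(i, i + k)} = frobenius t (\<alpha>(i := k - 1)) \<beta>"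
  using assms by (auto simp: frobenius_def split: if_splits)

lemma removable_frobenius_zero:
  assumes "decreasing_upto L t \<alpha>"
  shows "removable (frobenius t \<alpha> \<beta>) b \<and> box_content b = 0 \<longleftrightarrow>
    1 \<le> t \<and> \<alpha> t = 0 \<and> \<beta> t = 0 \<and> b = (t, t)"
proof (cases b)
  case (Pair i j)
  have "box_content (i, j) = 0 \<longleftrightarrow> j = i" by (auto simp: box_content_def)
  moreover have "i = t" if "\<alpha> i = 0" "1 \<le> i" "i \<le> t"
    using decreasing_uptoD(1)[OF assms, of i t] that by (cases "i < t") auto
  ultimately show ?thesis by (auto simp: Pair removable_def frobenius_def)
qed

lemma frobenius_delete_zero:
  assumes "1 \<le> t" "\<alpha> t = 0" "\<beta> t = 0"
  shows "frobenius t \<alpha> \<beta> - {(t, t)} = frobenius (t - 1) \<alpha> \<beta>"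
proof -
  have "(i, j) \<in> frobenius t \<alpha> \<beta> - {(t, t)} \<longleftrightarrow> (i, j) \<in> frobenius (t - 1) \<alpha> \<beta>" for i j
  proof -
    consider "i \<le> j" "i = t" | "i \<le> j" "i \<noteq> t" | "j < i" "j = t" | "j < i" "j \<noteq> t" by linarith
    then show ?thesis using assms by cases (auto simp: frobenius_def)
  qed
  then show ?thesis by auto
qed

section \<open>Giambelli determinants under adding boxes of one content\<close>

text \<open>Linearity of the determinant in row \<open>r\<close>, read off from the Laplace expansion along that row,
  whose cofactors do not involve the row itself.\<close>
lemma det_row_update:
  fixes A :: "nat \<Rightarrow> nat \<Rightarrow> 'a::comm_ring_1"
  assumes "r < t"
  shows "Determinant.det (Matrix.mat t t (\<lambda>(i, j). A i j + (if i = r then x * B j else 0))) =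
    Determinant.det (Matrix.mat t t (\<lambda>(i, j). A i j)) +
    x * Determinant.det (Matrix.mat t t (\<lambda>(i, j). if i = r then B j else A i j))"
proof -
  let ?M = "Matrix.mat t t (\<lambda>(i, j). A i j + (if i = r then x * B j else 0))"
  let ?A = "Matrix.mat t t (\<lambda>(i, j). A i j)"
  let ?B = "Matrix.mat t t (\<lambda>(i, j). if i = r then B j else A i j)"
  have "mat_delete ?M r j = mat_delete ?A r j" "mat_delete ?B r j = mat_delete ?A r j" if "j < t" for j
    using assms that by (auto simp: mat_delete_def intro!: eq_matI)
  then have c: "cofactor ?M r j = cofactor ?A r j" "cofactor ?B r j = cofactor ?A r j" if "j < t" for j
    using that by (simp_all add: cofactor_def)
  have "Determinant.det ?M = (\<Sum>j<t. (A r j + x * B j) * cofactor ?A r j)"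
    using assms by (subst laplace_expansion_row[of _ t r]) (auto simp: c intro!: sum.cong)
  moreover have "Determinant.det ?A = (\<Sum>j<t. A r j * cofactor ?A r j)"
    using assms by (subst laplace_expansion_row[of _ t r]) (auto intro!: sum.cong)
  moreover have "Determinant.det ?B = (\<Sum>j<t. B j * cofactor ?A r j)"
    using assms by (subst laplace_expansion_row[of _ t r]) (auto simp: c intro!: sum.cong)
  ultimately show ?thesis by (simp add: sum.distrib sum_distrib_left algebra_simps)
qed

lemma det_last_row_unit:
  fixes A :: "nat \<Rightarrow> nat \<Rightarrow> 'a::comm_ring_1"
  shows "Determinant.det (Matrix.mat (Suc t) (Suc t)
      (\<lambda>(i, j). if i = t then (if j = t then 1 else 0) else A i j)) =
    Determinant.det (Matrix.mat t t (\<lambda>(i, j). A i j))"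
proof -
  let ?M = "Matrix.mat (Suc t) (Suc t) (\<lambda>(i, j). if i = t then (if j = t then 1 else 0) else A i j)"
  have "Determinant.det ?M = (\<Sum>j<Suc t. (if j = t then cofactor ?M t j else 0))"
    by (subst laplace_expansion_row[of _ "Suc t" t]) (auto intro!: sum.cong)
  also have "\<dots> = cofactor ?M t t" by simp
  also have "\<dots> = Determinant.det (mat_delete ?M t t)"
    by (simp add: cofactor_def flip: mult_2)
  also have "mat_delete ?M t t = Matrix.mat t t (\<lambda>(i, j). A i j)"
    by (auto simp: mat_delete_def intro!: eq_matI)
  finally show ?thesis .
qed

text \<open>The linear recurrence satisfied by tableau sums when one more slot of content \<open>c\<close> becomes
  available. It forgets the tableaux and, unlike the row and column conditions on tableaux, is
  symmetric under transposition, which saves treating negative contents separately.\<close>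
definition adds_boxes ::
  "nat \<Rightarrow> int \<Rightarrow> 'a::comm_ring_1 \<Rightarrow> ((nat \<times> nat) set \<Rightarrow> 'a) \<Rightarrow> ((nat \<times> nat) set \<Rightarrow> 'a) \<Rightarrow> bool" where
  "adds_boxes L c x Z Z' \<longleftrightarrow> (\<forall>t \<alpha> \<beta>. decreasing_upto L t \<alpha> \<longrightarrow> decreasing_upto L t \<beta> \<longrightarrow>
     (\<forall>b. removable (frobenius t \<alpha> \<beta>) b \<and> box_content b = c \<longrightarrow>
        Z' (frobenius t \<alpha> \<beta>) = Z (frobenius t \<alpha> \<beta>) + x * Z (frobenius t \<alpha> \<beta> - {b})) \<and>
     ((\<nexists>b. removable (frobenius t \<alpha> \<beta>) b \<and> box_content b = c) \<longrightarrow>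
        Z' (frobenius t \<alpha> \<beta>) = Z (frobenius t \<alpha> \<beta>)))"

lemma adds_boxesD:
  assumes "adds_boxes L c x Z Z'" "decreasing_upto L t \<alpha>" "decreasing_upto L t \<beta>"
  shows "removable (frobenius t \<alpha> \<beta>) b \<and> box_content b = c \<Longrightarrow>
      Z' (frobenius t \<alpha> \<beta>) = Z (frobenius t \<alpha> \<beta>) + x * Z (frobenius t \<alpha> \<beta> - {b})"
    and "(\<And>b. \<not> (removable (frobenius t \<alpha> \<beta>) b \<and> box_content b = c)) \<Longrightarrow>
      Z' (frobenius t \<alpha> \<beta>) = Z (frobenius t \<alpha> \<beta>)"
  using assms unfolding adds_boxes_def by blast+

lemma adds_boxes_hook_pos:
  assumes "adds_boxes L (int k) x Z Z'" "1 \<le> k" "a \<le> L" "b \<le> L"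
  shows "Z' (hook_shape a b) = Z (hook_shape a b) + (if a = k then x * Z (hook_shape (k - 1) b) else 0)"
proof -
  note dec = assms(3,4)[folded decreasing_upto_one]
  note rem = removable_frobenius_pos[OF assms(2), of 1 "\<lambda>_. a" "\<lambda>_. b"]
  show ?thesis
  proof (cases "a = k")
    case True
    have "Z' (hook_shape a b) = Z (hook_shape a b) + x * Z (hook_shape a b - {(1, 1 + k)})"
      unfolding hook_shape_def by (rule adds_boxesD(1)[OF assms(1) dec]) (use rem True in auto)
    also have "hook_shape a b - {(1, 1 + k)} = frobenius 1 ((\<lambda>_. a)(1 := k - 1)) (\<lambda>_. b)"
      unfolding hook_shape_def by (rule frobenius_delete_pos) (use assms True in auto)
    also have "\<dots> = hook_shape (k - 1) b"
      unfolding hook_shape_def frobenius_def by auto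
    finally show ?thesis using True by simp
  next
    case False
    have "Z' (hook_shape a b) = Z (hook_shape a b)"
      unfolding hook_shape_def by (rule adds_boxesD(2)[OF assms(1) dec]) (use rem False in auto)
    then show ?thesis using False by simp
  qed
qed

text \<open>On the matrix of hook values \<open>H a b\<close>, the recurrence at content \<open>k > 0\<close> adds \<open>x\<close> times the row
  of arm length \<open>k - 1\<close> to the row of arm length \<open>k\<close>, if there is one. If \<open>k - 1\<close> is itself one of
  the arm lengths, this is a row operation inside the matrix and leaves the determinant unchanged,
  in accordance with the fact that no box of content \<open>k\<close> can be removed. Otherwise the correction is
  the Giambelli determinant of the diagram with that box removed.\<close>
lemma giambelli_add_pos:
  assumes Z: "giambelli L Z" and add: "adds_boxes L (int k) x Z Z'" and k: "1 \<le> k"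
  shows "giambelli L Z'"
  unfolding giambelli_def
proof (intro allI impI)
  fix t \<alpha> \<beta>
  assume dec: "decreasing_upto L t \<alpha>" "decreasing_upto L t \<beta>"
  define H where "H = (\<lambda>a b. Z (hook_shape a b))"
  define D where "D = frobenius t \<alpha> \<beta>"
  define A where "A = (\<lambda>i j. H (\<alpha> (i + 1)) (\<beta> (j + 1)))"
  note rem = removable_frobenius_pos[OF k, of t \<alpha> \<beta>]
  let ?det' = "Determinant.det (Matrix.mat t t (\<lambda>(i, j). Z' (hook_shape (\<alpha> (i + 1)) (\<beta> (j + 1)))))"
  have entry: "Z' (hook_shape (\<alpha> (i + 1)) (\<beta> (j + 1))) =
      A i j + (if \<alpha> (i + 1) = k then x * H (k - 1) (\<beta> (j + 1)) else 0)" if "i < t" "j < t" for i j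
    using adds_boxes_hook_pos[OF add k, of "\<alpha> (i + 1)" "\<beta> (j + 1)"]
      decreasing_uptoD(2)[OF dec(1), of "i + 1"] decreasing_uptoD(2)[OF dec(2), of "j + 1"] that
    by (simp add: A_def H_def)
  have ZD: "Z D = Determinant.det (Matrix.mat t t (\<lambda>(i, j). A i j))"
    using Z dec unfolding giambelli_def D_def A_def H_def by simp
  show "Z' (frobenius t \<alpha> \<beta>) = ?det'"
  proof (cases "\<exists>i\<in>{1..t}. \<alpha> i = k")
    case False
    then have "Z' D = Z D" unfolding D_def by (intro adds_boxesD(2)[OF add dec]) (use rem in auto)
    moreover have "?det' = Determinant.det (Matrix.mat t t (\<lambda>(i, j). A i j))"
      using False entry by (intro arg_cong[of _ _ Determinant.det] eq_matI) auto
    ultimately show ?thesis using ZD by (simp add: D_def)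
  next
    case True
    then obtain r where r: "r < t" "\<alpha> (r + 1) = k"
      by (metis Suc_eq_plus1 Suc_le_D Suc_le_eq atLeastAtMost_iff One_nat_def)
    have uniq: "\<alpha> (i + 1) = k \<longleftrightarrow> i = r" if "i < t" for i
      using decreasing_uptoD(1)[OF dec(1), of "i + 1" "r + 1"]
        decreasing_uptoD(1)[OF dec(1), of "r + 1" "i + 1"] r that
      by (cases i r rule: linorder_cases) auto
    let ?R = "Matrix.mat t t (\<lambda>(i, j). if i = r then H (k - 1) (\<beta> (j + 1)) else A i j)"
    have "?det' = Determinant.det (Matrix.mat t t (\<lambda>(i, j). A i j +
        (if i = r then x * H (k - 1) (\<beta> (j + 1)) else 0)))"
      using entry uniq by (intro arg_cong[of _ _ Determinant.det] eq_matI) auto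
    also have "\<dots> = Z D + x * Determinant.det ?R"
      unfolding ZD by (rule det_row_update[OF r(1)])
    finally have det': "?det' = Z D + x * Determinant.det ?R" .
    show ?thesis
    proof (cases "r + 1 < t \<and> \<alpha> (r + 2) + 1 = k")
      case same: True
      \<comment> \<open>No box can be removed, and correspondingly two rows of the correction coincide.\<close>
      have "Determinant.det ?R = 0"
      proof (rule Determinant.det_identical_rows)
        show "?R \<in> carrier_mat t t" by simp
        show "r \<noteq> r + 1" "r < t" "r + 1 < t" using same by auto
        have "\<alpha> (Suc (Suc r)) = k - 1" using same by auto
        then show "Matrix.row ?R r = Matrix.row ?R (r + 1)"
          using same by (auto simp: A_def intro!: eq_vecI)
      qed
      moreover have "Z' D = Z D"
        unfolding D_def
      proof (rule adds_boxesD(2)[OF add dec])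
        fix b
        show "\<not> (removable (frobenius t \<alpha> \<beta>) b \<and> box_content b = int k)"
        proof
          assume "removable (frobenius t \<alpha> \<beta>) b \<and> box_content b = int k"
          then obtain i where i: "i \<in> {1..t}" "\<alpha> i = k" "i < t \<Longrightarrow> \<alpha> (i + 1) + 1 < k"
            using iffD1[OF rem[of b]] by blast
          then have "i = r + 1" using uniq[of "i - 1"] by auto
          then show False using i same by auto
        qed
      qed
      ultimately show ?thesis using det' by (simp add: D_def)
    next
      case False
      let ?\<alpha> = "\<alpha>(r + 1 := k - 1)"
      have next_lt: "\<alpha> (r + 2) + 1 < k" if "r + 1 < t"
        using decreasing_uptoD(1)[OF dec(1), of "r + 1" "r + 2"] r that False by auto
      have "\<alpha> j < k - 1" if "r + 1 < j" "j \<le> t" for j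
        using decreasing_uptoD(1)[OF dec(1), of "r + 2" j] next_lt that
        by (cases "j = r + 2") auto
      then have dec': "decreasing_upto L t ?\<alpha>"
        using dec(1) r unfolding decreasing_upto_def
        by (smt (verit) One_nat_def atLeastAtMost_iff diff_le_self fun_upd_apply le_trans
            less_imp_diff_less order_less_le_trans)
      have "Z' D = Z D + x * Z (D - {(r + 1, r + 1 + k)})"
        unfolding D_def
        by (rule adds_boxesD(1)[OF add dec]) (use rem r next_lt in auto)
      also have "D - {(r + 1, r + 1 + k)} = frobenius t ?\<alpha> \<beta>"
        unfolding D_def by (rule frobenius_delete_pos) (use r k in auto)
      also have "Z (frobenius t ?\<alpha> \<beta>) = Determinant.det ?R"
        using Z dec' dec(2) unfolding giambelli_def
        by (auto simp: A_def H_def intro!: arg_cong[of _ _ Determinant.det] eq_matI)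
      finally show ?thesis using det' by (simp add: D_def)
    qed
  qed
qed

text \<open>At content \<open>0\<close> the only hook with a removable box is the single box. Its value is an entry of
  the matrix only if \<open>\<alpha> t = \<beta> t = 0\<close>; then it is the last diagonal entry, and raising it by \<open>x\<close>
  adds \<open>x\<close> times the complementary minor, the determinant for the diagram without \<open>(t, t)\<close>.\<close>
lemma giambelli_add_zero:
  assumes Z: "giambelli L Z" and add: "adds_boxes L 0 x Z Z'"
  shows "giambelli L Z'"
proof -
  have empty: "Z {} = 1"
  proof -
    have "decreasing_upto L 0 (\<lambda>_. 0)" by (simp add: decreasing_upto_def)
    then have "Z (frobenius 0 (\<lambda>_. 0) (\<lambda>_. 0)) = 1" using Z unfolding giambelli_def by fastforce
    moreover have "frobenius 0 (\<lambda>_. 0) (\<lambda>_. 0) = {}" by (auto simp: frobenius_def)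
    ultimately show ?thesis by simp
  qed
  have hook: "Z' (hook_shape a b) = Z (hook_shape a b) + (if a = 0 \<and> b = 0 then x else 0)"
    if "a \<le> L" "b \<le> L" for a b
  proof -
    note dec = that[folded decreasing_upto_one]
    note rem = removable_frobenius_zero[OF dec(1), of "\<lambda>_. b"]
    show ?thesis
    proof (cases "a = 0 \<and> b = 0")
      case True
      have "Z' (hook_shape a b) = Z (hook_shape a b) + x * Z (hook_shape a b - {(1, 1)})"
        unfolding hook_shape_def by (rule adds_boxesD(1)[OF add dec]) (use rem True in auto)
      also have "hook_shape a b - {(1, 1)} = {}"
        using True by (auto simp: hook_shape_def frobenius_def split: if_splits)
      finally show ?thesis using True empty by simp
    next
      case False
      have "Z' (hook_shape a b) = Z (hook_shape a b)"
        unfolding hook_shape_def by (rule adds_boxesD(2)[OF add dec]) (use rem False in auto)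
      then show ?thesis unfolding if_not_P[OF False] by simp
    qed
  qed
  show ?thesis
    unfolding giambelli_def
  proof (intro allI impI)
    fix t \<alpha> \<beta>
    assume dec: "decreasing_upto L t \<alpha>" "decreasing_upto L t \<beta>"
    define D where "D = frobenius t \<alpha> \<beta>"
    define A where "A = (\<lambda>i j. Z (hook_shape (\<alpha> (i + 1)) (\<beta> (j + 1))))"
    note rem = removable_frobenius_zero[OF dec(1), of \<beta>]
    let ?det' = "Determinant.det (Matrix.mat t t (\<lambda>(i, j). Z' (hook_shape (\<alpha> (i + 1)) (\<beta> (j + 1)))))"
    have last: "i = t - 1" if "\<gamma> (i + 1) = 0" "i < t" "decreasing_upto L t \<gamma>" for \<gamma> i
      using decreasing_uptoD(1)[OF that(3), of "i + 1" t] that by (cases "i + 1 < t") auto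
    have entry: "Z' (hook_shape (\<alpha> (i + 1)) (\<beta> (j + 1))) =
        A i j + (if \<alpha> (i + 1) = 0 \<and> \<beta> (j + 1) = 0 then x else 0)" if "i < t" "j < t" for i j
      using hook[of "\<alpha> (i + 1)" "\<beta> (j + 1)"]
        decreasing_uptoD(2)[OF dec(1), of "i + 1"] decreasing_uptoD(2)[OF dec(2), of "j + 1"] that
      by (simp add: A_def)
    have ZD: "Z D = Determinant.det (Matrix.mat t t (\<lambda>(i, j). A i j))"
      using Z dec unfolding giambelli_def D_def A_def by simp
    show "Z' (frobenius t \<alpha> \<beta>) = ?det'"
    proof (cases "1 \<le> t \<and> \<alpha> t = 0 \<and> \<beta> t = 0")
      case False
      then have no: "\<not> (\<alpha> (i + 1) = 0 \<and> \<beta> (j + 1) = 0)" if "i < t" "j < t" for i j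
        using last[of \<alpha> i] last[of \<beta> j] dec that by (metis One_nat_def Suc_eq_plus1 Suc_leI Suc_pred
            bot_nat_0.not_eq_extremum not_less0 zero_less_Suc)
      have "Z' D = Z D" unfolding D_def by (intro adds_boxesD(2)[OF add dec]) (use rem False in auto)
      moreover have "Z' (hook_shape (\<alpha> (i + 1)) (\<beta> (j + 1))) = A i j" if "i < t" "j < t" for i j
        unfolding entry[OF that] if_not_P[OF no[OF that]] by simp
      then have "?det' = Determinant.det (Matrix.mat t t (\<lambda>(i, j). A i j))"
        by (intro arg_cong[of _ _ Determinant.det] eq_matI) auto
      ultimately show ?thesis using ZD by (simp add: D_def)
    next
      case True
      then obtain u where u: "t = Suc u" by (cases t) auto
      have corner: "\<alpha> (i + 1) = 0 \<and> \<beta> (j + 1) = 0 \<longleftrightarrow> i = u \<and> j = u" if "i < t" "j < t" for i j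
        using last[of \<alpha> i] last[of \<beta> j] dec that True u by auto
      have "?det' = Determinant.det (Matrix.mat t t (\<lambda>(i, j). A i j +
          (if i = u then x * (if j = u then 1 else 0) else 0)))"
        using entry corner by (intro arg_cong[of _ _ Determinant.det] eq_matI) auto
      also have "\<dots> = Z D + x * Determinant.det (Matrix.mat t t
          (\<lambda>(i, j). if i = u then (if j = u then 1 else 0) else A i j))"
        unfolding ZD by (rule det_row_update) (simp add: u)
      also have "Determinant.det (Matrix.mat t t
          (\<lambda>(i, j). if i = u then (if j = u then 1 else 0) else A i j)) =
          Determinant.det (Matrix.mat u u (\<lambda>(i, j). A i j))"
        unfolding u by (rule det_last_row_unit)
      also have "\<dots> = Z (frobenius u \<alpha> \<beta>)"
        using Z dec unfolding giambelli_def A_def u decreasing_upto_def by simp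
      also have "frobenius u \<alpha> \<beta> = D - {(t, t)}"
        unfolding D_def using frobenius_delete_zero[of t \<alpha> \<beta>] True u by simp
      also have "Z D + x * Z (D - {(t, t)}) = Z' D"
        unfolding D_def by (rule adds_boxesD(1)[OF add dec, symmetric]) (use rem True in auto)
      finally show ?thesis by (simp add: D_def)
    qed
  qed
qed

lemma giambelli_swap:
  assumes "giambelli L Z"
  shows "giambelli L (\<lambda>D. Z (prod.swap ` D))"
  unfolding giambelli_def
proof (intro allI impI)
  fix t \<alpha> \<beta>
  assume dec: "decreasing_upto L t \<alpha>" "decreasing_upto L t \<beta>"
  let ?M = "Matrix.mat t t (\<lambda>(i, j). Z (hook_shape (\<beta> (i + 1)) (\<alpha> (j + 1))))"
  have "Z (prod.swap ` frobenius t \<alpha> \<beta>) = Determinant.det ?M"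
    using assms dec unfolding frobenius_swap giambelli_def by blast
  also have "\<dots> = Determinant.det (transpose_mat ?M)"
    by (rule Determinant.det_transpose[of ?M t, symmetric]) simp
  also have "transpose_mat ?M =
      Matrix.mat t t (\<lambda>(i, j). Z (prod.swap ` hook_shape (\<alpha> (i + 1)) (\<beta> (j + 1))))"
    unfolding hook_shape_def frobenius_swap by (auto intro!: eq_matI)
  finally show "Z (prod.swap ` frobenius t \<alpha> \<beta>) = Determinant.det (Matrix.mat t t
      (\<lambda>(i, j). Z (prod.swap ` hook_shape (\<alpha> (i + 1)) (\<beta> (j + 1)))))" .
qed

lemma removable_swap: "removable (prod.swap ` D) b \<longleftrightarrow> removable D (prod.swap b)"
  by (cases b) (force simp: removable_def image_iff)

lemma adds_boxes_swap:
  assumes "adds_boxes L c x Z Z'"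
  shows "adds_boxes L (- c) x (\<lambda>D. Z (prod.swap ` D)) (\<lambda>D. Z' (prod.swap ` D))"
  unfolding adds_boxes_def
proof (intro allI impI conjI)
  fix t \<alpha> \<beta>
  assume dec: "decreasing_upto L t \<alpha>" "decreasing_upto L t \<beta>"
  have rem: "removable (frobenius t \<alpha> \<beta>) (prod.swap b) \<and> box_content (prod.swap b) = - c \<longleftrightarrow>
      removable (frobenius t \<beta> \<alpha>) b \<and> box_content b = c" for b
    unfolding frobenius_swap[of t \<alpha> \<beta>, symmetric] removable_swap by (auto simp: box_content_def)
  show "Z' (prod.swap ` frobenius t \<alpha> \<beta>) =
      Z (prod.swap ` frobenius t \<alpha> \<beta>) + x * Z (prod.swap ` (frobenius t \<alpha> \<beta> - {b}))"
    if "removable (frobenius t \<alpha> \<beta>) b \<and> box_content b = - c" for b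
  proof -
    have "prod.swap ` (frobenius t \<alpha> \<beta> - {b}) = frobenius t \<beta> \<alpha> - {prod.swap b}"
      unfolding frobenius_swap[of t \<alpha> \<beta>, symmetric] by (subst image_set_diff) auto
    then show ?thesis
      using adds_boxesD(1)[OF assms dec(2,1), of "prod.swap b"] rem[of "prod.swap b"] that
      by (simp add: frobenius_swap)
  qed
  show "Z' (prod.swap ` frobenius t \<alpha> \<beta>) = Z (prod.swap ` frobenius t \<alpha> \<beta>)"
    if "\<nexists>b. removable (frobenius t \<alpha> \<beta>) b \<and> box_content b = - c"
    unfolding frobenius_swap by (rule adds_boxesD(2)[OF assms dec(2,1)]) (use rem that in blast)
qed

lemma giambelli_add:
  assumes "giambelli L Z" "adds_boxes L c x Z Z'"
  shows "giambelli L Z'"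
proof (cases c "0 :: int" rule: linorder_cases)
  case greater
  then show ?thesis using giambelli_add_pos[of L Z "nat c" x Z'] assms by simp
next
  case equal
  then show ?thesis using giambelli_add_zero assms by blast
next
  case less
  then have "giambelli L (\<lambda>D. Z' (prod.swap ` D))"
    using giambelli_add_pos[OF giambelli_swap[OF assms(1)], of "nat (- c)" x]
      adds_boxes_swap[OF assms(2)] by simp
  from giambelli_swap[OF this] show ?thesis by (simp add: image_image)
qed

section \<open>The finite Giambelli formula\<close>

lemma adds_boxes_sum_before:
  assumes "\<bar>c\<bar> \<le> int L" "1 \<le> n"
  shows "adds_boxes L c (w c n) (sum_before w L (slot L n c)) (sum_before w L (slot L n c + 1))"
  unfolding adds_boxes_def
proof (intro allI impI conjI)
  fix t \<alpha> \<beta>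
  assume dec: "decreasing_upto L t \<alpha>" "decreasing_upto L t \<beta>"
  note young = young_frobenius[OF dec] and bound = box_content_bound[OF dec]
  show "sum_before w L (slot L n c + 1) (frobenius t \<alpha> \<beta>) = sum_before w L (slot L n c) (frobenius t \<alpha> \<beta>) +
      w c n * sum_before w L (slot L n c) (frobenius t \<alpha> \<beta> - {b})"
    if "removable (frobenius t \<alpha> \<beta>) b \<and> box_content b = c" for b
    using sum_before_add_box[OF young _ assms(2) bound, of b w] that by blast
  show "sum_before w L (slot L n c + 1) (frobenius t \<alpha> \<beta>) = sum_before w L (slot L n c) (frobenius t \<alpha> \<beta>)"
    if "\<nexists>b. removable (frobenius t \<alpha> \<beta>) b \<and> box_content b = c"
    using sum_before_no_change[OF young _ bound assms(1), of w n] that by blast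
qed

lemma ssyt_empty: "ssyt {} = {\<lambda>_. undefined}"
  by (auto simp: ssyt_def)

lemma sum_before_empty: "sum_before w L \<tau> {} = 1"
  by (simp add: sum_before_def ssyt_before_def ssyt_empty weight_def)

text \<open>Before the first slot there are no tableaux except the empty one, and both sides vanish unless
  \<open>t = 0\<close>. Afterwards each integer \<open>\<tau>\<close> is either the code of a slot or changes nothing.\<close>
lemma giambelli_sum_before: "giambelli L (sum_before w L (int \<tau>))"
proof (induction \<tau>)
  case 0
  have zero: "sum_before w L 0 D = 0"
    if D: "D \<noteq> {}" "\<And>b. b \<in> D \<Longrightarrow> \<bar>box_content b\<bar> \<le> int L" for D
  proof -
    obtain b where b: "b \<in> D" using D(1) by blast
    have "\<not> slot L (m b) (box_content b) < 0" if "m \<in> ssyt D" for m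
    proof -
      have "1 * (2 * int L + 2) \<le> int (m b) * (2 * int L + 2)"
        using ssyt_pos[OF that b] by (intro mult_right_mono) auto
      moreover have "- int L \<le> box_content b" using D(2)[OF b] by linarith
      ultimately show ?thesis unfolding slot_def mult_1_left by linarith
    qed
    then have "ssyt_before L 0 D = {}" using b unfolding ssyt_before_def by blast
    then show ?thesis by (simp add: sum_before_def)
  qed
  show ?case
    unfolding giambelli_def
  proof (intro allI impI)
    fix t \<alpha> \<beta>
    assume dec: "decreasing_upto L t \<alpha>" "decreasing_upto L t \<beta>"
    show "sum_before w L (int 0) (frobenius t \<alpha> \<beta>) = Determinant.det (Matrix.mat t t
        (\<lambda>(i, j). sum_before w L (int 0) (hook_shape (\<alpha> (i + 1)) (\<beta> (j + 1)))))"
    proof (cases "t = 0")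
      case True
      moreover have "frobenius 0 \<alpha> \<beta> = {}" by (auto simp: frobenius_def)
      ultimately show ?thesis by (simp add: sum_before_empty)
    next
      case False
      then have "(1, 1) \<in> frobenius t \<alpha> \<beta>" by (auto simp: frobenius_def)
      then have "sum_before w L 0 (frobenius t \<alpha> \<beta>) = 0"
        using zero[OF _ box_content_bound[OF dec]] by blast
      moreover have "sum_before w L 0 (hook_shape (\<alpha> (i + 1)) (\<beta> (j + 1))) = 0" if "i < t" "j < t" for i j
      proof -
        have "decreasing_upto L 1 (\<lambda>_. \<alpha> (i + 1))" "decreasing_upto L 1 (\<lambda>_. \<beta> (j + 1))"
          using decreasing_uptoD(2)[OF dec(1), of "i + 1"] decreasing_uptoD(2)[OF dec(2), of "j + 1"] that
          unfolding decreasing_upto_one by auto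
        note bound = box_content_bound[OF this, folded hook_shape_def]
        have "(1, 1) \<in> hook_shape (\<alpha> (i + 1)) (\<beta> (j + 1))" by (auto simp: hook_shape_def frobenius_def)
        then show ?thesis using zero[OF _ bound] by blast
      qed
      then have "Matrix.mat t t (\<lambda>(i, j). sum_before w L 0 (hook_shape (\<alpha> (i + 1)) (\<beta> (j + 1)))) = 0\<^sub>m t t"
        by (auto intro!: eq_matI)
      ultimately show ?thesis using det_zero[of t] False by simp
    qed
  qed
next
  case (Suc \<tau>)
  show ?case
  proof (cases "\<exists>n c. int \<tau> = slot L n c \<and> 1 \<le> n \<and> \<bar>c\<bar> \<le> int L")
    case True
    then obtain n c where *: "int \<tau> = slot L n c" "1 \<le> n" "\<bar>c\<bar> \<le> int L" by blast
    have "giambelli L (sum_before w L (slot L n c + 1))"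
      using giambelli_add[OF _ adds_boxes_sum_before[OF *(3,2), of w]] Suc unfolding * by blast
    then show ?thesis using *(1) by (simp add: add.commute)
  next
    case False
    have "sum_before w L (int \<tau> + 1) (frobenius t \<alpha> \<beta>) = sum_before w L (int \<tau>) (frobenius t \<alpha> \<beta>)"
      if dec: "decreasing_upto L t \<alpha>" "decreasing_upto L t \<beta>" for t \<alpha> \<beta>
    proof -
      have "slot L (m b) (box_content b) \<noteq> int \<tau>" if "m \<in> ssyt (frobenius t \<alpha> \<beta>)" "b \<in> frobenius t \<alpha> \<beta>" for m b
        using False ssyt_pos[OF that] box_content_bound[OF dec that(2)] by metis
      then have "ssyt_before L (int \<tau> + 1) (frobenius t \<alpha> \<beta>) = ssyt_before L (int \<tau>) (frobenius t \<alpha> \<beta>)"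
        unfolding ssyt_before_def by (smt (verit) Collect_cong)
      then show ?thesis by (simp add: sum_before_def)
    qed
    note same = this
    \<comment> \<open>A step that admits no tableau is an instance of the recurrence with factor \<open>0\<close>.\<close>
    have "adds_boxes L 0 0 (sum_before w L (int \<tau>)) (sum_before w L (int \<tau> + 1))"
      unfolding adds_boxes_def using same by simp
    from giambelli_add[OF Suc this] show ?thesis by (simp add: add.commute)
  qed
qed

definition ssyt_upto :: "nat \<Rightarrow> (nat \<times> nat) set \<Rightarrow> (nat \<times> nat \<Rightarrow> nat) set" where
  "ssyt_upto N D = {m \<in> ssyt D. \<forall>b\<in>D. m b \<le> N}"

definition sum_upto :: "(int \<Rightarrow> nat \<Rightarrow> 'a::comm_ring_1) \<Rightarrow> nat \<Rightarrow> (nat \<times> nat) set \<Rightarrow> 'a" where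
  "sum_upto w N D = (\<Sum>m\<in>ssyt_upto N D. weight w D m)"

lemma finite_ssyt_upto: "finite D \<Longrightarrow> finite (ssyt_upto N D)"
  by (rule finite_subset[of _ "D \<rightarrow>\<^sub>E {..N}"])
    (auto simp: ssyt_upto_def ssyt_def PiE_iff extensional_def intro!: finite_PiE)

text \<open>The last slot with entry \<open>N\<close> is \<open>(N, L)\<close>.\<close>
lemma sum_upto_eq_sum_before:
  assumes "\<And>b. b \<in> D \<Longrightarrow> \<bar>box_content b\<bar> \<le> int L"
  shows "sum_upto w N D = sum_before w L (slot L N (int L) + 1) D"
proof -
  have "m b \<le> N \<longleftrightarrow> slot L (m b) (box_content b) < slot L N (int L) + 1" if b: "b \<in> D" for m b
  proof
    assume "m b \<le> N"
    then have "int (m b) * (2 * int L + 2) \<le> int N * (2 * int L + 2)" by (intro mult_right_mono) auto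
    then show "slot L (m b) (box_content b) < slot L N (int L) + 1"
      using assms[OF b] unfolding slot_def by linarith
  next
    assume "slot L (m b) (box_content b) < slot L N (int L) + 1"
    then show "m b \<le> N"
      using assms[OF b] by (intro slot_le_entry[of L "m b" "box_content b" N "int L"]) auto
  qed
  then have "ssyt_upto N D = ssyt_before L (slot L N (int L) + 1) D"
    by (auto simp: ssyt_upto_def ssyt_before_def)
  then show ?thesis by (simp add: sum_upto_def sum_before_def)
qed

lemma giambelli_sum_upto:
  assumes "decreasing_upto L t \<alpha>" "decreasing_upto L t \<beta>"
  shows "sum_upto w N (frobenius t \<alpha> \<beta>) = Determinant.det (Matrix.mat t t
    (\<lambda>(i, j). sum_upto w N (hook_shape (\<alpha> (i + 1)) (\<beta> (j + 1)))))"
proof -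
  have hook: "sum_upto w N (hook_shape (\<alpha> (i + 1)) (\<beta> (j + 1))) =
      sum_before w L (slot L N (int L) + 1) (hook_shape (\<alpha> (i + 1)) (\<beta> (j + 1)))" if "i < t" "j < t" for i j
  proof (rule sum_upto_eq_sum_before)
    fix b assume "b \<in> hook_shape (\<alpha> (i + 1)) (\<beta> (j + 1))"
    moreover have "decreasing_upto L 1 (\<lambda>_. \<alpha> (i + 1))" "decreasing_upto L 1 (\<lambda>_. \<beta> (j + 1))"
      using decreasing_uptoD(2)[OF assms(1), of "i + 1"] decreasing_uptoD(2)[OF assms(2), of "j + 1"] that
      unfolding decreasing_upto_one by auto
    ultimately show "\<bar>box_content b\<bar> \<le> int L"
      unfolding hook_shape_def using box_content_bound by blast
  qed
  have "0 \<le> slot L N (int L)" by (simp add: slot_def)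
  then have nat: "slot L N (int L) + 1 = int (nat (slot L N (int L) + 1))" by simp
  have "sum_upto w N (frobenius t \<alpha> \<beta>) = sum_before w L (slot L N (int L) + 1) (frobenius t \<alpha> \<beta>)"
    by (rule sum_upto_eq_sum_before) (rule box_content_bound[OF assms])
  also have "\<dots> = Determinant.det (Matrix.mat t t
      (\<lambda>(i, j). sum_before w L (slot L N (int L) + 1) (hook_shape (\<alpha> (i + 1)) (\<beta> (j + 1)))))"
    using giambelli_sum_before[of L w "nat (slot L N (int L) + 1)"] assms
    unfolding giambelli_def nat[symmetric] by blast
  also have "\<dots> = Determinant.det (Matrix.mat t t
      (\<lambda>(i, j). sum_upto w N (hook_shape (\<alpha> (i + 1)) (\<beta> (j + 1)))))"
    using hook by (intro arg_cong[of _ _ Determinant.det] eq_matI) auto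
  finally show ?thesis .
qed

section \<open>Passage to the limit\<close>

lemma ssyt_upto_exhaust:
  assumes "finite D"
  shows "filterlim (\<lambda>N. ssyt_upto N D) (finite_subsets_at_top (ssyt D)) sequentially"
  unfolding filterlim_finite_subsets_at_top
proof (intro allI impI)
  fix X assume X: "finite X \<and> X \<subseteq> ssyt D"
  have "\<forall>\<^sub>F N in sequentially. m \<in> ssyt_upto N D" if "m \<in> X" for m
    using eventually_ge_at_top[of "Max (m ` D)"]
  proof eventually_elim
    case (elim N)
    have "m b \<le> N" if "b \<in> D" for b
    proof -
      have "m b \<le> Max (m ` D)" using assms that by (intro Max_ge) auto
      then show ?thesis using elim by linarith
    qed
    then show ?case using X that by (auto simp: ssyt_upto_def)
  qed
  then have "\<forall>\<^sub>F N in sequentially. \<forall>m\<in>X. m \<in> ssyt_upto N D"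
    using X by (intro eventually_ball_finite) auto
  then show "\<forall>\<^sub>F N in sequentially. finite (ssyt_upto N D) \<and> X \<subseteq> ssyt_upto N D \<and> ssyt_upto N D \<subseteq> ssyt D"
    by eventually_elim (auto simp: finite_ssyt_upto assms, auto simp: ssyt_upto_def)
qed

lemma sum_upto_tendsto:
  fixes w :: "int \<Rightarrow> nat \<Rightarrow> 'a::{comm_ring_1, topological_comm_monoid_add, t2_space}"
  assumes "finite D" "weight w D summable_on ssyt D"
  shows "(\<lambda>N. sum_upto w N D) \<longlonglongrightarrow> infsum (weight w D) (ssyt D)"
  unfolding sum_upto_def
  using filterlim_compose[OF infsum_tendsto[OF assms(2)] ssyt_upto_exhaust[OF assms(1)]] .

lemma det_tendsto:
  fixes A :: "nat \<Rightarrow> nat \<Rightarrow> nat \<Rightarrow> 'a::real_normed_field"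
  assumes "\<And>i j. i < t \<Longrightarrow> j < t \<Longrightarrow> (\<lambda>N. A N i j) \<longlonglongrightarrow> B i j"
  shows "(\<lambda>N. Determinant.det (Matrix.mat t t (\<lambda>(i, j). A N i j)))
    \<longlonglongrightarrow> Determinant.det (Matrix.mat t t (\<lambda>(i, j). B i j))"
proof -
  have *: "Determinant.det (Matrix.mat t t (\<lambda>(i, j). M i j)) =
      (\<Sum>p | p permutes {0..<t}. signof p * (\<Prod>i = 0..<t. M i (p i)))" for M :: "nat \<Rightarrow> nat \<Rightarrow> 'a"
    by (subst Determinant.det_def'[of _ t])
      (auto intro!: sum.cong prod.cong simp: permutes_def dest: permutes_in_image)
  show ?thesis
    unfolding * by (intro tendsto_sum tendsto_mult tendsto_const tendsto_prod assms)
      (auto dest: permutes_in_image)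
qed

section \<open>Absolute convergence\<close>

text \<open>Splitting \<open>s = \<epsilon> + (1 + \<epsilon>)\<close>, the first factor is at most \<open>k powr - \<epsilon>\<close> on the range of summation
  and the second one gives a convergent series.\<close>
lemma power_tail_bound:
  fixes s :: real
  assumes "s > 1"
  shows "\<exists>\<epsilon>>0. \<exists>C\<ge>0. \<forall>k\<ge>1. \<forall>N. (\<Sum>x\<in>{k..N}. real x powr - s) \<le> C * real k powr - \<epsilon>"
proof (intro exI conjI allI impI)
  define \<epsilon> where "\<epsilon> = (s - 1) / 2"
  define f where "f = (\<lambda>x::nat. real x powr - (1 + \<epsilon>))"
  show eps: "\<epsilon> > 0" using assms by (simp add: \<epsilon>_def)
  have sum: "summable f" unfolding f_def using eps by (subst summable_real_powr_iff) auto
  show "suminf f \<ge> 0" using sum by (rule suminf_nonneg) (simp add: f_def)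
  fix k N :: nat
  assume k: "1 \<le> k"
  have "(\<Sum>x\<in>{k..N}. real x powr - s) \<le> (\<Sum>x\<in>{k..N}. real k powr - \<epsilon> * f x)"
  proof (rule sum_mono)
    fix x assume x: "x \<in> {k..N}"
    have "- s = - \<epsilon> + - (1 + \<epsilon>)" by (simp add: \<epsilon>_def field_simps)
    then have "real x powr - s = real x powr - \<epsilon> * f x" unfolding f_def by (metis powr_add)
    also have "\<dots> \<le> real k powr - \<epsilon> * f x"
      using x k eps by (intro mult_right_mono powr_mono2') (auto simp: f_def)
    finally show "real x powr - s \<le> real k powr - \<epsilon> * f x" .
  qed
  also have "\<dots> = sum f {k..N} * real k powr - \<epsilon>" by (simp add: sum_distrib_right mult.commute)
  also have "\<dots> \<le> suminf f * real k powr - \<epsilon>"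
    by (intro mult_right_mono sum_le_suminf[OF sum]) (auto simp: f_def)
  finally show "(\<Sum>x\<in>{k..N}. real x powr - s) \<le> suminf f * real k powr - \<epsilon>" .
qed

definition power_weight :: "(int \<Rightarrow> real) \<Rightarrow> int \<Rightarrow> nat \<Rightarrow> real" where
  "power_weight \<sigma> c n = real n powr - \<sigma> c"

lemma weight_power_nonneg: "weight (power_weight \<sigma>) D m \<ge> 0"
  by (auto simp: weight_def power_weight_def intro!: prod_nonneg)

text \<open>Fix all other entries and sum over the entry of one box. Only an upper bound is needed, so every condition on
  that entry except a single lower bound \<open>k\<close> is dropped.\<close>
lemma sum_upto_peel:
  assumes "finite D" "b \<in> D"
    and k: "\<And>m. m \<in> ssyt D \<Longrightarrow> k (m(b := undefined)) \<le> m b"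
  shows "sum_upto (power_weight \<sigma>) N D \<le> (\<Sum>m\<in>ssyt_upto N (D - {b}).
    weight (power_weight \<sigma>) (D - {b}) m * (\<Sum>x\<in>{k m..N}. real x powr - \<sigma> (box_content b)))"
proof -
  define w where "w = power_weight \<sigma>"
  define f where "f = (\<lambda>m::nat \<times> nat \<Rightarrow> nat. (m(b := undefined), m b))"
  define g where "g = (\<lambda>(m, x). weight w (D - {b}) m * w (box_content b) x)"
  let ?S = "Sigma (ssyt_upto N (D - {b})) (\<lambda>m. {k m..N})"
  have inj: "inj_on f (ssyt_upto N D)"
  proof (rule inj_onI)
    fix m m' assume "f m = f m'"
    then have "(m(b := undefined))(b := m b) = (m'(b := undefined))(b := m' b)" by (auto simp: f_def)
    then show "m = m'" by simp
  qed
  have sub: "f ` ssyt_upto N D \<subseteq> ?S"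
  proof (rule image_subsetI)
    fix m assume "m \<in> ssyt_upto N D"
    then show "f m \<in> ?S"
      using k[of m] ssyt_delete[of m D b] assms(2) by (auto simp: f_def ssyt_upto_def)
  qed
  have g: "weight w D m = g (f m)" for m
    using assms(1,2) by (simp add: weight_def g_def f_def prod.remove[of D b] mult.commute)
  have "sum_upto w N D = (\<Sum>m\<in>ssyt_upto N D. g (f m))" by (simp add: sum_upto_def g)
  also have "\<dots> = sum g (f ` ssyt_upto N D)" by (simp add: sum.reindex[OF inj])
  also have "\<dots> \<le> sum g ?S"
    using sub finite_ssyt_upto[of "D - {b}" N] assms(1)
    by (intro sum_mono2)
      (auto simp: g_def w_def power_weight_def[of \<sigma> "box_content b"] intro!: mult_nonneg_nonneg weight_power_nonneg)
  also have "\<dots> = (\<Sum>m\<in>ssyt_upto N (D - {b}). \<Sum>x\<in>{k m..N}. weight w (D - {b}) m * w (box_content b) x)"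
    unfolding g_def using finite_ssyt_upto[of "D - {b}" N] assms(1) by (subst sum.Sigma) auto
  finally show ?thesis by (simp add: w_def power_weight_def[of \<sigma> "box_content b"] sum_distrib_left)
qed

text \<open>Summing out a box whose exponent exceeds \<open>1\<close> leaves a negative power of the entry of its
  neighbour \<open>b'\<close>, which amounts to raising the exponent at \<open>b'\<close>. Exponents belong to diagonals,
  hence the condition that \<open>b'\<close> is alone on its diagonal.\<close>
lemma sum_upto_peel_bound:
  assumes "finite D" "b \<in> D" "b' \<in> D" "b' \<noteq> b" "\<sigma> (box_content b) > 1"
    and le: "\<And>m. m \<in> ssyt D \<Longrightarrow> m b' \<le> m b"
    and alone: "\<And>x. x \<in> D \<Longrightarrow> box_content x = box_content b' \<Longrightarrow> x = b'"
  shows "\<exists>\<epsilon>>0. \<exists>C\<ge>0. \<forall>N. sum_upto (power_weight \<sigma>) N D \<le>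
    C * sum_upto (power_weight (\<sigma>(box_content b' := \<sigma> (box_content b') + \<epsilon>))) N (D - {b})"
proof -
  obtain C \<epsilon> where C: "\<epsilon> > 0" "C \<ge> 0" and
    tail: "\<forall>k\<ge>1. \<forall>N. (\<Sum>x\<in>{k..N}. real x powr - \<sigma> (box_content b)) \<le> C * real k powr - \<epsilon>"
    using power_tail_bound[OF assms(5)] by blast
  let ?\<sigma> = "\<sigma>(box_content b' := \<sigma> (box_content b') + \<epsilon>)"
  have "sum_upto (power_weight \<sigma>) N D \<le> C * sum_upto (power_weight ?\<sigma>) N (D - {b})" for N
  proof -
    have split: "weight (power_weight ?\<sigma>) (D - {b}) m =
        weight (power_weight \<sigma>) (D - {b}) m * real (m b') powr - \<epsilon>" for m
    proof -
      have "(\<Prod>x\<in>D - {b} - {b'}. power_weight ?\<sigma> (box_content x) (m x)) =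
          (\<Prod>x\<in>D - {b} - {b'}. power_weight \<sigma> (box_content x) (m x))"
        using alone by (intro prod.cong) (auto simp: power_weight_def)
      moreover have "power_weight ?\<sigma> (box_content b') (m b') =
          power_weight \<sigma> (box_content b') (m b') * real (m b') powr - \<epsilon>"
        by (simp add: power_weight_def powr_diff powr_minus field_simps flip: powr_add)
      ultimately show ?thesis
        unfolding weight_def using assms(1,3,4) by (subst (1 2) prod.remove[of _ b']) auto
    qed
    have "sum_upto (power_weight \<sigma>) N D \<le> (\<Sum>m\<in>ssyt_upto N (D - {b}).
        weight (power_weight \<sigma>) (D - {b}) m * (\<Sum>x\<in>{m b'..N}. real x powr - \<sigma> (box_content b)))"
      using assms(4) le by (intro sum_upto_peel[OF assms(1,2)]) auto
    also have "\<dots> \<le> (\<Sum>m\<in>ssyt_upto N (D - {b}).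
        weight (power_weight \<sigma>) (D - {b}) m * (C * real (m b') powr - \<epsilon>))"
    proof (intro sum_mono mult_left_mono weight_power_nonneg)
      fix m assume "m \<in> ssyt_upto N (D - {b})"
      then have "1 \<le> m b'" using assms(3,4) ssyt_pos[of m "D - {b}" b'] by (auto simp: ssyt_upto_def)
      then show "(\<Sum>x\<in>{m b'..N}. real x powr - \<sigma> (box_content b)) \<le> C * real (m b') powr - \<epsilon>"
        using tail by blast
    qed
    also have "\<dots> = C * sum_upto (power_weight ?\<sigma>) N (D - {b})"
      unfolding sum_upto_def split by (simp add: sum_distrib_left mult.left_commute)
    finally show ?thesis .
  qed
  then show ?thesis using C by blast
qed

lemma mem_hook_shape:
  "(i, j) \<in> hook_shape a b \<longleftrightarrow> i = 1 \<and> 1 \<le> j \<and> j \<le> a + 1 \<or> j = 1 \<and> 1 \<le> i \<and> i \<le> b + 1"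
  by (auto simp: hook_shape_def frobenius_def)

lemma finite_hook_shape: "finite (hook_shape a b)"
  by (rule finite_subset[of _ "{..b + 1} \<times> {..a + 1}"]) (auto simp: mem_hook_shape)

text \<open>Peel the hook from the ends of its arm and leg. After an end box is summed out, the new end box
  had exponent at least \<open>1\<close> and has gained some \<open>\<epsilon> > 0\<close>, so that the hypotheses are restored.\<close>
lemma hook_sum_upto_bounded:
  assumes "\<And>c. - int b \<le> c \<Longrightarrow> c \<le> int a \<Longrightarrow> \<sigma> c \<ge> 1"
    and "\<sigma> (int a) > 1" "\<sigma> (- int b) > 1"
  shows "\<exists>C. \<forall>N. sum_upto (power_weight \<sigma>) N (hook_shape a b) \<le> C"
  using assms
proof (induction "a + b" arbitrary: a b \<sigma>)
  case 0
  then have ab: "a = 0" "b = 0" by auto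
  have hook: "hook_shape 0 0 = {(1, 1)}" by (auto simp: mem_hook_shape)
  have "\<sigma> 0 > 1" using 0 by simp
  then obtain C \<epsilon> where C: "\<forall>k\<ge>1. \<forall>N. (\<Sum>x\<in>{k..N}. real x powr - \<sigma> 0) \<le> C * real k powr - \<epsilon>"
    using power_tail_bound by blast
  have "sum_upto (power_weight \<sigma>) N (hook_shape 0 0) \<le> C" for N
  proof -
    have "sum_upto (power_weight \<sigma>) N (hook_shape 0 0) \<le> (\<Sum>m\<in>ssyt_upto N ({} :: (nat \<times> nat) set).
        weight (power_weight \<sigma>) {} m * (\<Sum>x\<in>{1..N}. real x powr - \<sigma> 0))"
      using sum_upto_peel[of "{(1::nat, 1::nat)}" "(1, 1)" "\<lambda>_. 1" \<sigma> N] ssyt_pos[of _ "{(1, 1)}" "(1, 1)"]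
      by (simp add: hook box_content_def)
    also have "\<dots> = (\<Sum>x\<in>{1..N}. real x powr - \<sigma> 0)"
      by (simp add: ssyt_upto_def ssyt_empty weight_def)
    also have "\<dots> \<le> C" using spec[OF mp[OF spec[OF C, of 1]], of N] by simp
    finally show ?thesis .
  qed
  then show ?case using ab by blast
next
  case (Suc n)
  have step: "\<exists>C. \<forall>N. sum_upto (power_weight \<sigma>) N (hook_shape a b) \<le> C"
    if ab: "a' + b' = n" and x: "x \<in> hook_shape a b" and x': "x' \<in> hook_shape a b" "x' \<noteq> x"
      and del: "hook_shape a b - {x} = hook_shape a' b'" and le: "\<And>m. m \<in> ssyt (hook_shape a b) \<Longrightarrow> m x' \<le> m x"
      and big: "\<sigma> (box_content x) > 1"
      and ends: "int a' = box_content x' \<or> \<sigma> (int a') > 1" "- int b' = box_content x' \<or> \<sigma> (- int b') > 1"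
      and sub: "a' \<le> a" "b' \<le> b"
    for a' b' x x'
  proof -
    have alone: "y = x'" if "y \<in> hook_shape a b" "box_content y = box_content x'" for y
      using that x'(1) by (cases y; cases x') (auto simp: mem_hook_shape box_content_def)
    obtain C \<epsilon> where C: "\<epsilon> > 0" "C \<ge> 0" "\<forall>N. sum_upto (power_weight \<sigma>) N (hook_shape a b) \<le>
        C * sum_upto (power_weight (\<sigma>(box_content x' := \<sigma> (box_content x') + \<epsilon>))) N (hook_shape a' b')"
      using sum_upto_peel_bound[where D = "hook_shape a b" and b = x and b' = x' and \<sigma> = \<sigma>,
          OF finite_hook_shape x x' big le alone]
      unfolding del by blast
    let ?\<sigma> = "\<sigma>(box_content x' := \<sigma> (box_content x') + \<epsilon>)"
    have ge: "?\<sigma> c \<ge> 1" if "- int b' \<le> c" "c \<le> int a'" for c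
      using Suc.prems(1)[of c] C(1) sub that by auto
    have "?\<sigma> (int a') > 1" "?\<sigma> (- int b') > 1"
      using ends C(1) Suc.prems(1)[of "int a'"] Suc.prems(1)[of "- int b'"] sub by auto
    from Suc.hyps(1)[OF ab[symmetric] ge this]
    obtain B where B: "sum_upto (power_weight ?\<sigma>) N (hook_shape a' b') \<le> B" for N by blast
    have "sum_upto (power_weight \<sigma>) N (hook_shape a b) \<le> C * B" for N
      using spec[OF C(3), of N] mult_left_mono[OF B[of N] C(2)] by linarith
    then show ?thesis by blast
  qed
  show ?case
  proof (cases a)
    case (Suc a')
    show ?thesis
    proof (rule step[of a' b "(1, a + 1)" "(1, a)"])
      show "hook_shape a b - {(1, a + 1)} = hook_shape a' b"
        using Suc by (auto simp: mem_hook_shape)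
      show "m (1, a) \<le> m (1, a + 1)" if "m \<in> ssyt (hook_shape a b)" for m
        using that Suc by (auto simp: ssyt_def mem_hook_shape)
    qed (use Suc Suc.hyps(2) Suc.prems in \<open>auto simp: mem_hook_shape box_content_def\<close>)
  next
    case 0
    then obtain b' where b': "b = Suc b'" using Suc.hyps(2) by (cases b) auto
    show ?thesis
    proof (rule step[of a b' "(b + 1, 1)" "(b, 1)"])
      show "hook_shape a b - {(b + 1, 1)} = hook_shape a b'"
        using b' by (auto simp: mem_hook_shape)
      show "m (b, 1) \<le> m (b + 1, 1)" if "m \<in> ssyt (hook_shape a b)" for m
        using that b' by (auto simp: ssyt_def mem_hook_shape intro!: less_imp_le)
    qed (use 0 b' Suc.hyps(2) Suc.prems in \<open>auto simp: mem_hook_shape box_content_def\<close>)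
  qed
qed

definition zeta_weight :: "(int \<Rightarrow> complex) \<Rightarrow> int \<Rightarrow> nat \<Rightarrow> complex" where
  "zeta_weight a c n = of_nat n powr (- a c)"

lemma norm_weight_zeta:
  assumes "m \<in> ssyt D"
  shows "norm (weight (zeta_weight a) D m) = weight (power_weight (\<lambda>c. Re (a c))) D m"
proof -
  have "norm (zeta_weight a c n) = power_weight (\<lambda>c. Re (a c)) c n" if "1 \<le> n" for c n
    using norm_powr_real_powr[of "of_nat n" "- a c"] that by (simp add: zeta_weight_def power_weight_def)
  then show ?thesis
    unfolding weight_def prod_norm[symmetric] using ssyt_pos[OF assms] by (intro prod.cong) blast+
qed

lemma zeta_summable:
  assumes "finite D" "\<And>N. sum_upto (power_weight (\<lambda>c. Re (a c))) N D \<le> C"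
  shows "weight (power_weight (\<lambda>c. Re (a c))) D summable_on ssyt D"
    and "weight (zeta_weight a) D summable_on ssyt D"
proof -
  let ?w = "weight (power_weight (\<lambda>c. Re (a c))) D"
  have bound: "sum ?w F \<le> C" if F: "F \<subseteq> ssyt D" "finite F" for F
  proof -
    have "\<forall>\<^sub>F N in sequentially. finite (ssyt_upto N D) \<and> F \<subseteq> ssyt_upto N D"
      using ssyt_upto_exhaust[OF assms(1)] F unfolding filterlim_finite_subsets_at_top
      by (auto elim: eventually_mono)
    then obtain N where N: "finite (ssyt_upto N D)" "F \<subseteq> ssyt_upto N D"
      using eventually_happens[of _ sequentially] by auto
    have "sum ?w F \<le> sum_upto (power_weight (\<lambda>c. Re (a c))) N D"
      unfolding sum_upto_def using N by (intro sum_mono2) (auto intro: weight_power_nonneg)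
    then show ?thesis using assms(2)[of N] by linarith
  qed
  show sum: "?w summable_on ssyt D"
    using bound by (intro nonneg_bdd_above_summable_on weight_power_nonneg bdd_aboveI2[of _ _ C]) auto
  have "weight (zeta_weight a) D abs_summable_on ssyt D"
    using sum by (rule iffD2[OF summable_on_cong, rotated]) (rule norm_weight_zeta)
  then show "weight (zeta_weight a) D summable_on ssyt D" by (rule abs_summable_summable)
qed

text \<open>Convergence for the whole diagram follows from convergence for hooks by the finite identity
  itself: applied to the absolute values of the summands, whose exponents \<open>Re (a c)\<close> are again
  constant along diagonals, it expresses the truncated sums as determinants of convergent
  sequences, so they are bounded.\<close>
theorem giambelli_zeta:
  fixes a :: "int \<Rightarrow> complex"
  assumes dec: "decreasing_upto L t \<alpha>" "decreasing_upto L t \<beta>"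
    and ge: "\<And>i j c. i \<in> {1..t} \<Longrightarrow> j \<in> {1..t} \<Longrightarrow> - int (\<beta> j) \<le> c \<Longrightarrow> c \<le> int (\<alpha> i) \<Longrightarrow> Re (a c) \<ge> 1"
    and gt: "\<And>i. i \<in> {1..t} \<Longrightarrow> Re (a (int (\<alpha> i))) > 1" "\<And>i. i \<in> {1..t} \<Longrightarrow> Re (a (- int (\<beta> i))) > 1"
  shows "infsum (weight (zeta_weight a) (frobenius t \<alpha> \<beta>)) (ssyt (frobenius t \<alpha> \<beta>)) =
    Determinant.det (Matrix.mat t t (\<lambda>(i, j). infsum
      (weight (zeta_weight a) (hook_shape (\<alpha> (i + 1)) (\<beta> (j + 1)))) (ssyt (hook_shape (\<alpha> (i + 1)) (\<beta> (j + 1))))))"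
proof -
  let ?D = "frobenius t \<alpha> \<beta>" and ?H = "\<lambda>i j. hook_shape (\<alpha> (i + 1)) (\<beta> (j + 1))"
  let ?\<sigma> = "\<lambda>c. Re (a c)"
  have fin: "finite ?D" using young_frobenius[OF dec] by (simp add: young_def)
  have hooks: "weight (power_weight ?\<sigma>) (?H i j) summable_on ssyt (?H i j)"
    "weight (zeta_weight a) (?H i j) summable_on ssyt (?H i j)" if "i < t" "j < t" for i j
  proof -
    have "\<exists>C. \<forall>N. sum_upto (power_weight ?\<sigma>) N (?H i j) \<le> C"
      using ge[of "i + 1" "j + 1"] gt(1)[of "i + 1"] gt(2)[of "j + 1"] that
      by (intro hook_sum_upto_bounded) auto
    then show "weight (power_weight ?\<sigma>) (?H i j) summable_on ssyt (?H i j)"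
      "weight (zeta_weight a) (?H i j) summable_on ssyt (?H i j)"
      using zeta_summable[OF finite_hook_shape] by blast+
  qed
  have "(\<lambda>N. sum_upto (power_weight ?\<sigma>) N ?D) \<longlonglongrightarrow> Determinant.det (Matrix.mat t t
      (\<lambda>(i, j). infsum (weight (power_weight ?\<sigma>) (?H i j)) (ssyt (?H i j))))"
    unfolding giambelli_sum_upto[OF dec]
    by (intro det_tendsto sum_upto_tendsto finite_hook_shape hooks)
  then have "Bseq (\<lambda>N. sum_upto (power_weight ?\<sigma>) N ?D)" by (intro convergent_imp_Bseq convergentI)
  then obtain C where "\<And>N. norm (sum_upto (power_weight ?\<sigma>) N ?D) \<le> C" by (auto simp: Bseq_def)
  then have "\<And>N. sum_upto (power_weight ?\<sigma>) N ?D \<le> C" by (metis abs_le_D1 real_norm_def)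
  from zeta_summable(2)[OF fin this]
  have "(\<lambda>N. sum_upto (zeta_weight a) N ?D) \<longlonglongrightarrow> infsum (weight (zeta_weight a) ?D) (ssyt ?D)"
    by (rule sum_upto_tendsto[OF fin])
  moreover have "(\<lambda>N. sum_upto (zeta_weight a) N ?D) \<longlonglongrightarrow> Determinant.det (Matrix.mat t t
      (\<lambda>(i, j). infsum (weight (zeta_weight a) (?H i j)) (ssyt (?H i j))))"
    unfolding giambelli_sum_upto[OF dec]
    by (intro det_tendsto sum_upto_tendsto finite_hook_shape hooks)
  ultimately show ?thesis by (rule LIMSEQ_unique)
qed

section \<open>Partitions in Frobenius coordinates\<close>

lemma ssyt_diagram: "SSYT lam = ssyt (diagram lam)"
  by (simp add: SSYT_def ssyt_def fillings_def)

lemma part_antimono: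
  assumes "is_partition lam" "1 \<le> i" "i \<le> i'"
  shows "part lam i' \<le> part lam i"
proof (cases "i < i' \<and> i' \<le> length lam")
  case True
  then have "lam ! (i' - 1) \<le> lam ! (i - 1)"
    using assms sorted_wrt_nth_less[of "\<lambda>x y. y \<le> x" lam "i - 1" "i' - 1"]
    by (auto simp: is_partition_def)
  then show ?thesis using True assms by (simp add: part_def)
next
  case False
  then show ?thesis using assms by (cases "i = i'") (auto simp: part_def)
qed

lemma mem_diagram: "(i, j) \<in> diagram lam \<longleftrightarrow> 1 \<le> i \<and> 1 \<le> j \<and> j \<le> part lam i"
  by (auto simp: diagram_def part_def)

lemma downset_eq_interval:
  fixes S :: "nat set"
  assumes "finite S" "\<And>i. i \<in> S \<Longrightarrow> 1 \<le> i" "\<And>i j. i \<in> S \<Longrightarrow> 1 \<le> j \<Longrightarrow> j \<le> i \<Longrightarrow> j \<in> S"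
  shows "S = {1..card S}"
proof (cases "S = {}")
  case False
  have S: "S = {1..Max S}"
  proof (intro equalityI subsetI)
    fix i assume "i \<in> S"
    then show "i \<in> {1..Max S}" using assms(2)[of i] Max_ge[OF assms(1), of i] by simp
  next
    fix i assume "i \<in> {1..Max S}"
    then show "i \<in> S" using assms(3)[OF Max_in[OF assms(1) False], of i] by simp
  qed
  then have "card S = Max S" by (metis card_atLeastAtMost diff_Suc_1)
  with S show ?thesis by simp
qed simp

text \<open>The rows of length at least \<open>j\<close> form an initial segment, of length \<open>conj_part lam j\<close>.\<close>
lemma conj_part_galois:
  assumes "is_partition lam" "1 \<le> i" "1 \<le> j"
  shows "i \<le> conj_part lam j \<longleftrightarrow> j \<le> part lam i"
proof -
  let ?S = "{i. 1 \<le> i \<and> i \<le> length lam \<and> part lam i \<ge> j}"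
  have "finite ?S" by (rule finite_subset[of _ "{..length lam}"]) auto
  moreover have "i' \<in> ?S" if "i \<in> ?S" "1 \<le> i'" "i' \<le> i" for i i'
    using part_antimono[OF assms(1) that(2,3)] that by auto
  ultimately have S: "?S = {1..conj_part lam j}"
    unfolding conj_part_def by (intro downset_eq_interval) auto
  have "i \<le> conj_part lam j \<longleftrightarrow> i \<in> ?S" unfolding S using assms by simp
  also have "\<dots> \<longleftrightarrow> j \<le> part lam i" using assms by (auto simp: part_def)
  finally show ?thesis .
qed

lemma conj_part_antimono:
  assumes "is_partition lam" "1 \<le> i" "i \<le> i'"
  shows "conj_part lam i' \<le> conj_part lam i"
proof (cases "conj_part lam i' = 0")
  case False
  then have "i' \<le> part lam (conj_part lam i')"
    using conj_part_galois[OF assms(1), of "conj_part lam i'" i'] assms by simp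
  then show ?thesis
    using conj_part_galois[OF assms(1), of "conj_part lam i'" i] assms False by simp
qed simp

lemma le_diag_length:
  assumes "is_partition lam" "1 \<le> i"
  shows "i \<le> diag_length lam \<longleftrightarrow> i \<le> part lam i"
proof -
  let ?S = "{i. (i, i) \<in> diagram lam}"
  have "finite ?S" by (rule finite_subset[of _ "{..length lam}"]) (auto simp: diagram_def)
  moreover have "i' \<in> ?S" if "i \<in> ?S" "1 \<le> i'" "i' \<le> i" for i i'
    using part_antimono[OF assms(1) that(2,3)] that by (auto simp: mem_diagram)
  ultimately have S: "?S = {1..diag_length lam}"
    unfolding diag_length_def by (intro downset_eq_interval) (auto simp: mem_diagram)
  have "i \<le> diag_length lam \<longleftrightarrow> i \<in> ?S" unfolding S using assms by simp
  then show ?thesis using assms by (simp add: mem_diagram)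
qed

lemma diagram_frobenius:
  assumes lam: "is_partition lam"
  shows "diagram lam =
    frobenius (diag_length lam) (\<lambda>i. part lam i - i) (\<lambda>i. conj_part lam i - i)"
proof -
  have "(i, j) \<in> diagram lam \<longleftrightarrow>
      (i, j) \<in> frobenius (diag_length lam) (\<lambda>i. part lam i - i) (\<lambda>i. conj_part lam i - i)" for i j
  proof (cases "1 \<le> i \<and> 1 \<le> j")
    case True
    show ?thesis
    proof (cases "i \<le> j")
      case le: True
      then show ?thesis
        using True le_diag_length[OF lam, of i] by (auto simp: mem_diagram frobenius_def)
    next
      case False
      have "j \<le> diag_length lam" if "i \<le> conj_part lam j"
        using conj_part_galois[OF lam, of j j] le_diag_length[OF lam, of j] True False that by linarith
      then show ?thesis
        using True False conj_part_galois[OF lam, of i j] by (auto simp: mem_diagram frobenius_def)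
    qed
  qed (auto simp: mem_diagram frobenius_def)
  then show ?thesis by auto
qed

lemma decreasing_upto_diff:
  fixes f :: "nat \<Rightarrow> nat"
  assumes "\<And>i j. 1 \<le> i \<Longrightarrow> i \<le> j \<Longrightarrow> f j \<le> f i" "\<And>j. 1 \<le> j \<Longrightarrow> j \<le> t \<Longrightarrow> j \<le> f j" "f 1 \<le> L"
  shows "decreasing_upto L t (\<lambda>i. f i - i)"
  unfolding decreasing_upto_def
proof (intro conjI allI impI ballI)
  fix i j assume "1 \<le> i" "i < j" "j \<le> t"
  then show "f j - j < f i - i" using assms(1)[of i j] assms(2)[of j] by linarith
next
  fix i assume "i \<in> {1..t}"
  then show "f i - i \<le> L" using assms(1)[of 1 i] assms(3) by simp
qed

lemma decreasing_parts:
  assumes lam: "is_partition lam" and L: "part lam 1 \<le> L" "conj_part lam 1 \<le> L"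
  shows "decreasing_upto L (diag_length lam) (\<lambda>i. part lam i - i)"
    and "decreasing_upto L (diag_length lam) (\<lambda>i. conj_part lam i - i)"
proof -
  have "j \<le> part lam j" "j \<le> conj_part lam j" if "1 \<le> j" "j \<le> diag_length lam" for j
    using le_diag_length[OF lam that(1)] conj_part_galois[OF lam that(1) that(1)] that by auto
  then show "decreasing_upto L (diag_length lam) (\<lambda>i. part lam i - i)"
    "decreasing_upto L (diag_length lam) (\<lambda>i. conj_part lam i - i)"
    using part_antimono[OF lam] conj_part_antimono[OF lam] L
    by (intro decreasing_upto_diff; blast)+
qed

lemma diagram_hook: "diagram (hook (a + 1) b) = hook_shape a b"
  by (auto simp: mem_diagram mem_hook_shape part_def hook_def nth_Cons' split: if_splits)

lemma schur_zeta_eq: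
  assumes "\<And>b. b \<in> diagram lam \<Longrightarrow> s b = a (box_content b)"
  shows "schur_zeta lam s = infsum (weight (zeta_weight a) (diagram lam)) (ssyt (diagram lam))"
  unfolding schur_zeta_def ssyt_diagram
  by (intro infsum_cong) (simp add: weight_def zeta_weight_def assms cong: prod.cong)

lemma hook_filling_content:
  assumes "b \<in> hook_shape p q"
  shows "hook_filling a (p + 1) q b = a (box_content b)"
proof (cases b)
  case (Pair k l)
  then show ?thesis
    using assms unfolding hook_filling_def diagram_hook
    by (auto simp: mem_hook_shape box_content_def)
qed

text \<open>The corners of a hook are among the ends of its arm and its leg.\<close>
lemma hook_filling_in_W:
  assumes ge: "\<And>c. - int q \<le> c \<Longrightarrow> c \<le> int p \<Longrightarrow> Re (a c) \<ge> 1"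
    and gt: "Re (a (int p)) > 1" "Re (a (- int q)) > 1"
  shows "hook_filling a (p + 1) q \<in> W (hook (p + 1) q)"
proof -
  have "Re (a (box_content b)) \<ge> 1" if "b \<in> hook_shape p q" for b
    using that by (cases b) (auto simp: mem_hook_shape box_content_def intro!: ge)
  moreover have "Re (a (box_content b)) > 1" if b: "b \<in> corners (hook (p + 1) q)" for b
  proof -
    obtain k l where kl: "b = (k, l)" by fastforce
    have "k = 1 \<and> l = p + 1 \<or> l = 1 \<and> k = q + 1"
      using b unfolding corners_def diagram_hook kl by (auto simp: mem_hook_shape)
    then show ?thesis using gt kl by (auto simp: box_content_def)
  qed
  moreover have "hook_filling a (p + 1) q \<in> fillings (hook (p + 1) q) UNIV"
    by (simp add: hook_filling_def fillings_def)
  moreover have "corners (hook (p + 1) q) \<subseteq> hook_shape p q"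
    unfolding corners_def diagram_hook by auto
  ultimately show ?thesis
    unfolding W_def diagram_hook using hook_filling_content[of _ p q a] by (auto simp: subset_iff)
qed

theorem theorem4p5:
  fixes lam :: "nat list" and t :: nat and p q :: "nat \<Rightarrow> nat"
    and s :: "nat \<times> nat \<Rightarrow> complex" and a :: "int \<Rightarrow> complex"
  assumes "is_partition lam"
    and "t = diag_length lam"
    and "\<And>i. i \<in> {1..t} \<Longrightarrow> p i = part lam i - i + 1"
    and "\<And>i. i \<in> {1..t} \<Longrightarrow> q i = conj_part lam i - i"
    and "s \<in> W_diag lam"
    and "\<And>i j. (i, j) \<in> diagram lam \<Longrightarrow> a (int j - int i) = s (i, j)"
    and "\<And>i. i \<in> {1..t} \<Longrightarrow> Re (s (i, part lam i)) > 1"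
    and "\<And>i. i \<in> {1..t} \<Longrightarrow> Re (s (conj_part lam i, i)) > 1"
  shows "(\<forall>i\<in>{1..t}. \<forall>j\<in>{1..t}. hook_filling a (p i) (q j) \<in> W (hook (p i) (q j))) \<and>
    schur_zeta lam s =
      Determinant.det (Matrix.mat t t (\<lambda>(i, j).
        schur_zeta (hook (p (i + 1)) (q (j + 1))) (hook_filling a (p (i + 1)) (q (j + 1)))))"
proof -
  note lam = assms(1)
  define \<alpha> where "\<alpha> = (\<lambda>i. part lam i - i)"
  define \<beta> where "\<beta> = (\<lambda>i. conj_part lam i - i)"
  define L where "L = max (part lam 1) (conj_part lam 1)"
  have dec: "decreasing_upto L t \<alpha>" "decreasing_upto L t \<beta>"
    unfolding \<alpha>_def \<beta>_def assms(2) by (intro decreasing_parts[OF lam]; simp add: L_def)+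
  have D: "diagram lam = frobenius t \<alpha> \<beta>"
    unfolding \<alpha>_def \<beta>_def assms(2) by (rule diagram_frobenius[OF lam])
  have s: "s b = a (box_content b)" if "b \<in> diagram lam" for b
    using assms(6)[of "fst b" "snd b"] that by (simp add: box_content_def)
  have ge_D: "Re (a (box_content b)) \<ge> 1" if b: "b \<in> diagram lam" for b
  proof -
    have "Re (s b) > 1 \<or> Re (s b) \<ge> 1"
      using assms(5) b unfolding W_diag_def W_def by blast
    then show ?thesis using s[OF b] by auto
  qed
  have row: "part lam i = i + \<alpha> i" and col: "conj_part lam i = i + \<beta> i" if "i \<in> {1..t}" for i
    using le_diag_length[OF lam, of i] conj_part_galois[OF lam, of i i] that assms(2)
    by (auto simp: \<alpha>_def \<beta>_def)
  have ge: "Re (a c) \<ge> 1"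
    if ij: "i \<in> {1..t}" "j \<in> {1..t}" and c: "- int (\<beta> j) \<le> c" "c \<le> int (\<alpha> i)" for i j c
  proof (cases "c \<ge> 0")
    case True
    then have "(i, i + nat c) \<in> frobenius t \<alpha> \<beta>" using ij c by (auto simp: frobenius_def)
    from ge_D[unfolded D, OF this] True show ?thesis by (simp add: box_content_def)
  next
    case False
    then have "(j + nat (- c), j) \<in> frobenius t \<alpha> \<beta>" using ij c by (auto simp: frobenius_def)
    from ge_D[unfolded D, OF this] False show ?thesis by (simp add: box_content_def)
  qed
  have gt: "Re (a (int (\<alpha> i))) > 1" "Re (a (- int (\<beta> i))) > 1" if i: "i \<in> {1..t}" for i
  proof -
    have "(i, part lam i) \<in> diagram lam" "(conj_part lam i, i) \<in> diagram lam"
      unfolding D row[OF i] col[OF i] using i by (auto simp: frobenius_def)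
    from assms(6)[OF this(1)] assms(6)[OF this(2)] assms(7,8)[OF i]
    show "Re (a (int (\<alpha> i))) > 1" "Re (a (- int (\<beta> i))) > 1" by (auto simp: row[OF i] col[OF i])
  qed
  have pq: "p i = \<alpha> i + 1" "q i = \<beta> i" if "i \<in> {1..t}" for i
    using assms(3,4)[OF that] by (auto simp: \<alpha>_def \<beta>_def)
  have "hook_filling a (p i) (q j) \<in> W (hook (p i) (q j))" if "i \<in> {1..t}" "j \<in> {1..t}" for i j
    unfolding pq(1)[OF that(1)] pq(2)[OF that(2)]
    using ge[OF that] gt(1)[OF that(1)] gt(2)[OF that(2)] by (rule hook_filling_in_W)
  moreover have hook: "schur_zeta (hook (p (i + 1)) (q (j + 1))) (hook_filling a (p (i + 1)) (q (j + 1))) =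
      infsum (weight (zeta_weight a) (hook_shape (\<alpha> (i + 1)) (\<beta> (j + 1))))
        (ssyt (hook_shape (\<alpha> (i + 1)) (\<beta> (j + 1))))" if "i < t" "j < t" for i j
  proof -
    have "p (i + 1) = \<alpha> (i + 1) + 1" "q (j + 1) = \<beta> (j + 1)" using pq that by simp_all
    then show ?thesis
      using schur_zeta_eq[of "hook (\<alpha> (i + 1) + 1) (\<beta> (j + 1))"
          "hook_filling a (\<alpha> (i + 1) + 1) (\<beta> (j + 1))" a]
      unfolding diagram_hook by (simp only: hook_filling_content)
  qed
  moreover have "schur_zeta lam s = Determinant.det (Matrix.mat t t (\<lambda>(i, j).
        schur_zeta (hook (p (i + 1)) (q (j + 1))) (hook_filling a (p (i + 1)) (q (j + 1)))))"
  proof -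
    have "schur_zeta lam s = infsum (weight (zeta_weight a) (frobenius t \<alpha> \<beta>)) (ssyt (frobenius t \<alpha> \<beta>))"
      using schur_zeta_eq[of lam s a, OF s] D by simp
    also have "\<dots> = Determinant.det (Matrix.mat t t (\<lambda>(i, j). infsum
        (weight (zeta_weight a) (hook_shape (\<alpha> (i + 1)) (\<beta> (j + 1))))
        (ssyt (hook_shape (\<alpha> (i + 1)) (\<beta> (j + 1))))))"
      by (rule giambelli_zeta[OF dec ge gt])
    also have "\<dots> = Determinant.det (Matrix.mat t t (\<lambda>(i, j).
        schur_zeta (hook (p (i + 1)) (q (j + 1))) (hook_filling a (p (i + 1)) (q (j + 1)))))"
      using hook by (intro arg_cong[of _ _ Determinant.det] eq_matI) auto
    finally show ?thesis .
  qed
  ultimately show ?thesis by blast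
qed

end
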